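(* Let $\mathbb F$ be a finite field of order $k\ge 4$. The value distribution of every read-once polynomial function over $\mathbb F$ on independent uniform inputs belongs to $\mathcal B_k$. That is, if $f:\mathbb F^N\to\mathbb F$ is computed by a read-once formula over $\mathbb F$ and $X_1,\dots,X_N$ are independent and uniformly distributed on $\mathbb F$, then the law of $f(X_1,\dots,X_N)$ belongs to $\mathcal B_k$.
   Context: For an integer $k\ge 2$ and $t\in[0,1]$ put $\psi_k(t):=\dfrac{1-t-(1-t)^k}{k-1}$. For a probability law $p$ on a set of $k$ points, let $p_1^{\downarrow}\ge p_2^{\downarrow}\ge\cdots\ge p_k^{\downarrow}$ be its atoms sorted in decreasing order (with multiplicity). The body $\mathcal B_k$ is the set of probability laws $p$ on $k$ points with $p_k^{\downarrow}\ge\psi_k(p_2^{\downarrow})$. A read-once formula over $\mathbb F$ is a binary tree whose internal nodes (gates) are labelled by field addition $+$ or field multiplication $\times$ and whose leaves are labelled by variables or by constants of $\mathbb F$, such that no variable occurs at more than one leaf (constants may be repeated). A read-once polynomial function is a function computed by a read-once formula. *)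

theory Defs
  imports "HOL-Probability.Probability"
begin

definition psi :: "nat \<Rightarrow> real \<Rightarrow> real" where
  "psi k t = (1 - t - (1 - t) ^ k) / (real k - 1)"

text \<open>The \<open>j\<close>-th largest atom, counted with multiplicity; \<open>j\<close> is 1-based as in
  \<open>p\<^sub>1 \<ge> \<dots> \<ge> p\<^sub>k\<close>, so it is only meaningful for \<open>1 \<le> j \<le> card (space p)\<close>.\<close>

definition atom_desc :: "'a measure \<Rightarrow> nat \<Rightarrow> real" where
  "atom_desc p j =
     rev (sorted_list_of_multiset
           (image_mset (\<lambda>x. measure p {x}) (mset_set (space p)))) ! (j - 1)"

definition law_body :: "nat \<Rightarrow> 'a measure set" where
  "law_body k = {p. prob_space p \<and> finite (space p) \<and> card (space p) = k \<and>
     sets p = Pow (space p) \<and> atom_desc p k \<ge> psi k (atom_desc p 2)}"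

datatype 'a formula =
    Var nat
  | Const 'a
  | Add "'a formula" "'a formula"
  | Mul "'a formula" "'a formula"

primrec eval_formula :: "'a::field formula \<Rightarrow> (nat \<Rightarrow> 'a) \<Rightarrow> 'a" where
  "eval_formula (Var i) x = x i"
| "eval_formula (Const c) x = c"
| "eval_formula (Add F G) x = eval_formula F x + eval_formula G x"
| "eval_formula (Mul F G) x = eval_formula F x * eval_formula G x"

text \<open>One list entry per leaf labelled by a variable.\<close>

primrec var_leaves :: "'a formula \<Rightarrow> nat list" where
  "var_leaves (Var i) = [i]"
| "var_leaves (Const c) = []"
| "var_leaves (Add F G) = var_leaves F @ var_leaves G"
| "var_leaves (Mul F G) = var_leaves F @ var_leaves G"

definition read_once :: "'a formula \<Rightarrow> bool" where
  "read_once F \<longleftrightarrow> distinct (var_leaves F)"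

text \<open>Points of the \<open>N\<close>-dimensional coordinate space are the extensional functions on
  \<open>{..<N}\<close>; the values of \<open>f\<close> elsewhere are irrelevant.\<close>

definition read_once_function :: "nat \<Rightarrow> ((nat \<Rightarrow> 'a::field) \<Rightarrow> 'a) \<Rightarrow> bool" where
  "read_once_function N f \<longleftrightarrow>
     (\<exists>F. read_once F \<and> set (var_leaves F) \<subseteq> {..<N} \<and>
          (\<forall>x \<in> {..<N} \<rightarrow>\<^sub>E UNIV. f x = eval_formula F x))"

end

theory Submission
  imports Defs
begin

text \<open>A law on \<open>k\<close> points with second largest atom \<open>t\<close> lies in the body exactly when every atom is at
least \<open>psi k t\<close>. Point masses and the uniform law qualify, and the two inputs of a gate of a
read-once formula are independent, so everything rests on one fact: the class is closed under
the law of \<open>Y + Z\<close> and the law of \<open>Y * Z\<close> for independent \<open>Y\<close>, \<open>Z\<close>.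

Let \<open>p\<close>, \<open>q\<close> be two such laws with second atoms \<open>t\<close>, \<open>t'\<close> and floors \<open>m = psi k t\<close>,
\<open>n = psi k t'\<close>. Splitting \<open>q = n + (q - n)\<close> exhibits the combination with \<open>q\<close> as a constant part
plus a mixture of translates of \<open>p\<close> whose total weight \<open>b\<close> is the mass of \<open>q - n\<close>
(\<open>weighted_sum_ge\<close> and its companions). This bounds all atoms of the combination from below and
all but one of them from above.

For addition take \<open>t \<le> t'\<close>. All atoms are at least \<open>n + b * m\<close>, and all but the one at the sum
of the two peaks are at most \<open>t' + b * t\<close>. Since \<open>psi k\<close> is concave with \<open>psi k 0 = 0\<close>, raising
its argument from \<open>t'\<close> by at most \<open>b * t\<close> raises its value by at most \<open>b * psi k t\<close>.

For multiplication, zero is absorbing, and the argument depends on where the peaks are.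

\<^item> Both peaks nonzero. The relation \<open>(k - 1) * psi k t = (1 - t) - (1 - t) ^ k\<close> says that the
  floor removes from the mass \<open>1 - t\<close> all but its \<open>k\<close>-th power, and masses of the group of
  units multiply (\<open>psi_le_product_floor\<close>). The remaining danger is that zero becomes the
  largest atom of the product; then a reflection property of \<open>psi k\<close> is needed
  (\<open>psi_le_reflect\<close>).

\<^item> The peak of \<open>p\<close> at zero and that of \<open>q\<close> not. Let \<open>Q\<close> be the mass of \<open>q\<close> off zero.
  Multiplication by \<open>q\<close> multiplies the mass of \<open>p\<close> off zero by \<open>Q\<close> and the oscillation of \<open>p\<close>
  off zero by at most \<open>Q ^ k\<close>. Laws on the boundary of the body may oscillate that much: along
  it, oscillation divided by the \<open>k\<close>-th power of the mass decreases in the second atom (\<open>excess_bulk_ratio_antimono\<close>, \<open>psi_le_mixture\<close>).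

\<^item> Both peaks at zero. Now the contraction factor of the oscillation may exceed \<open>Q ^ k\<close>, but a
  cruder quadratic estimate along the boundary suffices once the law with the larger second
  atom is used as the operator (\<open>smoothing_quadratic\<close>, \<open>psi_le_mixture_of_dispersed\<close>).\<close>

section \<open>The boundary function\<close>

lemma psi_mult:
  assumes "k \<ge> 2"
  shows "(real k - 1) * psi k t = 1 - t - (1 - t) ^ k"
  using assms by (simp add: psi_def)

lemma psi_0 [simp]: "psi k 0 = 0"
  by (simp add: psi_def)

lemma psi_nonneg:
  assumes "k \<ge> 2" "0 \<le> t" "t \<le> 1"
  shows "0 \<le> psi k t"
proof -
  have "(1 - t) ^ k \<le> (1 - t) ^ 1"
    using assms by (intro power_decreasing) auto
  then show ?thesis using assms by (auto simp: psi_def)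
qed

lemma psi_pos:
  assumes "k \<ge> 2" "0 < t" "t < 1"
  shows "0 < psi k t"
proof -
  have "(1 - t) ^ k < (1 - t) ^ 1"
    using assms by (intro power_strict_decreasing) auto
  then show ?thesis using assms by (auto simp: psi_def)
qed

lemma psi_le_self:
  assumes "k \<ge> 2" "t \<le> 1"
  shows "psi k t \<le> t"
proof -
  have "1 + real k * (- t) \<le> (1 + (- t)) ^ k"
    using assms by (intro Bernoulli_inequality) auto
  then have "(real k - 1) * psi k t \<le> (real k - 1) * t"
    unfolding psi_mult[OF assms(1)] by (simp add: algebra_simps)
  then show ?thesis using assms by simp
qed

lemma has_derivative_psi:
  assumes "k \<ge> 2"
  shows "(psi k has_real_derivative (real k * (1 - t) ^ (k - 1) - 1) / (real k - 1)) (at t)"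
  unfolding psi_def[abs_def] using assms
  by (auto intro!: derivative_eq_intros simp: divide_simps)

lemma psi_mono_slope:
  assumes "k \<ge> 2" "x \<le> t" "t \<le> 1" "1 \<le> real k * (1 - t) ^ (k - 1)"
  shows "psi k x \<le> psi k t"
proof (rule DERIV_nonneg_imp_nondecreasing[OF \<open>x \<le> t\<close>])
  fix s assume s: "x \<le> s" "s \<le> t"
  have "(1 - t) ^ (k - 1) \<le> (1 - s) ^ (k - 1)"
    using assms s by (intro power_mono) auto
  then have "real k * (1 - t) ^ (k - 1) \<le> real k * (1 - s) ^ (k - 1)"
    by (intro mult_left_mono) auto
  then have "0 \<le> (real k * (1 - s) ^ (k - 1) - 1) / (real k - 1)"
    using assms by (intro divide_nonneg_nonneg) linarith+
  then show "\<exists>y. (psi k has_real_derivative y) (at s) \<and> 0 \<le> y"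
    using has_derivative_psi[OF assms(1)] by blast
qed

lemma concave_psi:
  assumes "k \<ge> 2"
  shows "concave_on {0..1} (psi k)"
proof (rule f''_le0_imp_concave)
  show "(psi k has_real_derivative (real k * (1 - t) ^ (k - 1) - 1) / (real k - 1)) (at t)" for t
    using has_derivative_psi[OF assms] .
  show "((\<lambda>t. (real k * (1 - t) ^ (k - 1) - 1) / (real k - 1)) has_real_derivative
      - (real k * (1 - t) ^ (k - 2))) (at t)" for t
    using assms 
    by (auto intro!: derivative_eq_intros simp: divide_simps numeral_2_eq_2) 
qed (use assms in auto)

text \<open>Slopes of a concave function decrease, so a step starting at \<open>t'\<close> gains less per unit than the
initial step from \<open>0\<close> to \<open>t\<close>.\<close>

lemma psi_increment_le:
  assumes "k \<ge> 2" "0 < t" "t \<le> t'" "0 \<le> x" "t' + x \<le> 1"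
  shows "psi k (t' + x) - psi k t' \<le> x * (psi k t / t)"
proof (cases "x = 0")
  case False
  have "\<exists>z>0. z < t \<and> psi k t - psi k 0 = (t - 0) * ((real k * (1 - z) ^ (k - 1) - 1) / (real k - 1))"
    using assms by (intro MVT2 has_derivative_psi) auto
  then obtain z where z: "0 < z" "z < t"
    "psi k t = t * ((real k * (1 - z) ^ (k - 1) - 1) / (real k - 1))" by auto
  have "\<exists>y>t'. y < t' + x \<and> psi k (t' + x) - psi k t' =
     (t' + x - t') * ((real k * (1 - y) ^ (k - 1) - 1) / (real k - 1))"
    using assms False by (intro MVT2 has_derivative_psi) auto
  then obtain y where y: "t' < y" "y < t' + x"
    "psi k (t' + x) - psi k t' = x * ((real k * (1 - y) ^ (k - 1) - 1) / (real k - 1))" by auto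
  have "(1 - y) ^ (k - 1) \<le> (1 - z) ^ (k - 1)"
    using assms y z by (intro power_mono) auto
  then have "(real k * (1 - y) ^ (k - 1) - 1) / (real k - 1)
      \<le> (real k * (1 - z) ^ (k - 1) - 1) / (real k - 1)"
    using assms by (intro divide_right_mono diff_right_mono mult_left_mono) auto
  moreover have "psi k t / t = (real k * (1 - z) ^ (k - 1) - 1) / (real k - 1)"
    using assms z by simp
  ultimately show ?thesis unfolding y(3) using assms by (intro mult_left_mono) auto
qed simp

section \<open>Values that a second atom can take\<close>

text \<open>How far the second atom of a boundary law stands above its floor.\<close>

definition excess :: "nat \<Rightarrow> real \<Rightarrow> real" where
  "excess k t = t - psi k t"

text \<open>The mass off the peak of a law with second atom \<open>t\<close> whose other atoms all sit on the floor; no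
law of the body with second atom \<open>t\<close> has less mass there.\<close>

definition bulk :: "nat \<Rightarrow> real \<Rightarrow> real" where
  "bulk k t = t + (real k - 2) * psi k t"

text \<open>Since the peak has mass at least \<open>t\<close>, these are the only second atoms that occur in the body.\<close>

definition admissible :: "nat \<Rightarrow> real \<Rightarrow> bool" where
  "admissible k t \<longleftrightarrow> 0 \<le> t \<and> t \<le> 1 \<and> t + bulk k t \<le> 1"

lemma bulk_alt: 
  assumes "k \<ge> 2"
  shows "bulk k t = excess k t + (1 - t - (1 - t) ^ k)"
  using psi_mult[OF assms, of t] by (simp add: bulk_def excess_def algebra_simps)

lemma excess_mult:
  assumes "k \<ge> 2"
  shows "(real k - 1) * excess k t = real k - 1 - real k * (1 - t) + (1 - t) ^ k"
  using psi_mult[OF assms, of t] by (simp add: excess_def algebra_simps)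

lemma bulk_nonneg:
  assumes "k \<ge> 2" "0 \<le> t" "t \<le> 1"
  shows "0 \<le> bulk k t"
  using assms psi_nonneg[of k t] by (simp add: bulk_def)

lemma le_bulk:
  assumes "k \<ge> 2" "0 \<le> t" "t \<le> 1"
  shows "t \<le> bulk k t"
  using assms psi_nonneg[of k t] by (simp add: bulk_def)

lemma admissible_iff:
  assumes "k \<ge> 2"
  shows "admissible k t \<longleftrightarrow> 0 \<le> t \<and> t \<le> 1 \<and> excess k t \<le> (1 - t) ^ k"
  using psi_mult[OF assms, of t] by (auto simp: admissible_def bulk_alt[OF assms] algebra_simps)

lemma admissible_le_half:
  assumes "k \<ge> 2" "admissible k t" 
  shows "t \<le> 1 / 2"
  using assms le_bulk[of k t] by (simp add: admissible_def)

text \<open>The left-hand side stays below \<open>exp 2 < 8\<close>, which leaves only the cases \<open>k < 8\<close> to compute.\<close>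

lemma one_plus_two_div_power_le:
  assumes "k \<ge> 2"
  shows "(1 + 2 / real k) ^ (k - 1) \<le> real k"
proof (cases "k \<ge> 8")
  case True
  have "(1 + 2 / real k) ^ (k - 1) \<le> (1 + 2 / real k) ^ k"
    using assms by (intro power_increasing) auto
  also have "\<dots> \<le> exp (2 / real k) ^ k"
    by (intro power_mono) (auto intro: exp_ge_add_one_self)
  also have "\<dots> = exp 2"
    using assms by (simp flip: exp_of_nat_mult)
  also have "\<dots> = exp 1 * exp (1::real)"
    by (simp flip: exp_add)
  also have "\<dots> \<le> 2.8 * 2.8"
    using e_less_272 by (intro mult_mono) auto
  also have "\<dots> \<le> real k" using True by simp
  finally show ?thesis .
next
  case False
  then have "k \<in> {2,3,4,5,6,7}" using assms by auto
  then show ?thesis by (auto simp: power_numeral_reduce)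
qed

text \<open>The right-hand side minus one is a positive multiple of the derivative of \<open>psi k\<close>, so admissible
values lie on the increasing branch of \<open>psi k\<close>. If \<open>k * (1 - t) ^ (k - 1) < 1\<close>, then
admissibility forces \<open>1 - t \<ge> k / (k + 2)\<close>, and \<open>one_plus_two_div_power_le\<close> gives a
contradiction.\<close>

lemma admissible_slope:
  assumes "k \<ge> 2" "admissible k t"
  shows "1 \<le> real k * (1 - t) ^ (k - 1)"
proof (rule ccontr)
  define u where "u = 1 - t"
  define e where "e = u ^ (k - 1)"
  assume "\<not> ?thesis"
  then have e: "real k * e < 1" by (simp add: e_def u_def)
  have u: "0 < u" "u \<le> 1" using admissible_le_half[OF assms] assms by (auto simp: u_def admissible_def)
  have ue: "u ^ k = u * e" using assms by (simp add: e_def power_eq_if[of _ k])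
  have "(real k - 1) * excess k t \<le> (real k - 1) * (u * e)"
    using assms by (intro mult_left_mono) (auto simp: admissible_iff ue u_def[symmetric])
  then have 1: "real k - 1 \<le> real k * u + (real k - 2) * (u * e)"
    using excess_mult[OF assms(1), of t] by (simp add: u_def[symmetric] ue algebra_simps)
  have "real k * (real k - 1) \<le> real k * (real k * u + (real k - 2) * (u * e))"
    using 1 by (intro mult_left_mono) auto
  also have "\<dots> = real k * real k * u + (real k - 2) * u * (real k * e)"
    by (simp add: algebra_simps)
  also have "\<dots> \<le> real k * real k * u + (real k - 2) * u * 1"
    using e u assms by (intro add_left_mono mult_left_mono) auto
  also have "\<dots> = (real k - 1) * ((real k + 2) * u)" by (simp add: algebra_simps)
  finally have "(real k - 1) * real k \<le> (real k - 1) * ((real k + 2) * u)" by (simp add: mult.commute)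
  then have "real k \<le> (real k + 2) * u" using assms by simp
  then have "1 \<le> (1 + 2 / real k) * u" using assms by (simp add: field_simps)
  then have "1 ^ (k - 1) \<le> ((1 + 2 / real k) * u) ^ (k - 1)" by (intro power_mono) auto
  also have "\<dots> = (1 + 2 / real k) ^ (k - 1) * e" by (simp add: e_def power_mult_distrib)
  also have "\<dots> \<le> real k * e"
    using one_plus_two_div_power_le[OF assms(1)] u by (intro mult_right_mono) (auto simp: e_def)
  finally show False using e by simp
qed

lemma psi_mono_admissible:
  assumes "k \<ge> 2" "admissible k t" "x \<le> t"
  shows "psi k x \<le> psi k t"
  using assms admissible_slope[OF assms(1,2)] by (intro psi_mono_slope) (auto simp: admissible_def)

lemma admissible_antimono:
  assumes "k \<ge> 2" "admissible k t" "0 \<le> x" "x \<le> t"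
  shows "admissible k x"
proof -
  have "(real k - 2) * psi k x \<le> (real k - 2) * psi k t"
    using psi_mono_admissible assms by (intro mult_left_mono) auto
  then show ?thesis using assms by (simp add: admissible_def bulk_def)
qed

lemma admissible_le_psi:
  assumes "k \<ge> 2" "admissible k t"
  shows "t \<le> real k * psi k t"
proof -
  define u where "u = 1 - t"
  have u: "0 \<le> u" "u \<le> 1" using assms by (auto simp: u_def admissible_def)
  have "real k * (u * u ^ i) \<ge> 1" if "i < k - 1" for i
  proof -
    have "real k * u ^ (k - 1) \<le> real k * u ^ Suc i"
      using u that by (intro mult_left_mono power_decreasing) auto
    then show ?thesis using admissible_slope[OF assms] by (simp add: u_def)
  qed
  then have "(\<Sum>i<k - 1. 1) \<le> (\<Sum>i<k - 1. real k * (u * u ^ i))" by (intro sum_mono) auto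
  then have "(1 - u) * (real k - 1) \<le> (1 - u) * (real k * u * (\<Sum>i<k - 1. u ^ i))"
    using assms u by (intro mult_left_mono) (auto simp: sum_distrib_left mult.assoc of_nat_diff)
  also have "\<dots> = real k * u * ((1 - u) * (\<Sum>i<k - 1. u ^ i))" by (simp add: mult_ac)
  also have "(1 - u) * (\<Sum>i<k - 1. u ^ i) = 1 - u ^ (k - 1)"
    by (simp only: one_diff_power_eq)
  also have "real k * u * (1 - u ^ (k - 1)) = real k * (u - u ^ k)"
    using assms by (simp add: algebra_simps power_eq_if[of _ k])
  finally have "(real k - 1) * t \<le> real k * ((real k - 1) * psi k t)"
    unfolding psi_mult[OF assms(1)] u_def[symmetric] by (simp add: u_def algebra_simps)
  then have "(real k - 1) * t \<le> (real k - 1) * (real k * psi k t)" by (simp add: mult_ac)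
  then show ?thesis using assms by simp
qed

section \<open>Contraction along the boundary of the body\<close>

text \<open>In terms of \<open>u = 1 - t\<close>, this says that the derivative of \<open>excess k t / bulk k t ^ k\<close> is not
positive. Division by \<open>u ^ (k - 1)\<close> turns the difference of the two sides into a function
\<open>D\<close> with \<open>D 1 = 0\<close> whose derivative factors as
\<open>- (k - 2) * (1 - e) * (k * e - 1) / e\<close> with \<open>e = x ^ (k - 1)\<close>, and \<open>k * e \<ge> 1\<close> in the range considered.\<close>

lemma excess_bulk_slope:
  fixes u :: real
  assumes "k \<ge> 2" "0 < u" "u \<le> 1" "1 \<le> real k * u ^ (k - 1)"
  shows "u * (1 - u ^ (k - 1))\<^sup>2
    \<le> (real k - 1) * u ^ (k - 1) * (real k - 1 - real k * u + u ^ k)"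
proof -
  obtain j where k: "k = j + 2" using assms(1) by (metis add.commute le_Suc_ex)
  define K where "K = real k"
  define D where "D = (\<lambda>x. (K - 1)\<^sup>2 - (K - 2) * (K + 1) * x + (K - 2) * x ^ (j + 2) - 1 / x ^ j)"
  have K: "real j = K - 2" by (simp add: K_def k)
  have "D 1 \<le> D u"
  proof (rule DERIV_nonpos_imp_nonincreasing[OF \<open>u \<le> 1\<close>])
    fix x assume x: "u \<le> x" "x \<le> 1"
    then have x0: "0 < x" using assms by simp
    define e where "e = x ^ (j + 1)"
    have "u ^ (j + 1) \<le> e" unfolding e_def using x assms by (intro power_mono) auto
    then have "K * u ^ (j + 1) \<le> K * e" by (intro mult_left_mono) (auto simp: K_def)
    moreover have "1 \<le> K * u ^ (j + 1)" using assms by (simp add: K_def k)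
    ultimately have e: "1 \<le> K * e" by linarith
    have e1: "0 < e" "e \<le> 1" using x0 x by (auto simp: e_def power_le_one simp del: power_Suc)
    have d1: "((\<lambda>x. 1 / x ^ j) has_real_derivative - (K - 2) / e) (at x)"
    proof -
      have "((\<lambda>x. 1 / x ^ j) has_real_derivative - (real j * x ^ (j - 1)) / (x ^ j * x ^ j)) (at x)"
        using x0 by (auto intro!: derivative_eq_intros)
      moreover have "- (real j * x ^ (j - 1)) / (x ^ j * x ^ j) = - (K - 2) / e"
        using x0 by (cases j) (auto simp: K[symmetric] e_def field_simps)
      ultimately show ?thesis by simp
    qed
    have d2: "((\<lambda>x. x ^ (j + 2)) has_real_derivative K * e) (at x)"
      using DERIV_pow[of "j + 2" x UNIV] by (simp add: K_def k e_def)
    have "(D has_real_derivative - (K - 2) * (K + 1) + (K - 2) * (K * e) + (K - 2) / e) (at x)"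
      unfolding D_def
      by (rule DERIV_cong[OF DERIV_diff[OF DERIV_add[OF DERIV_diff[OF DERIV_const
            DERIV_cmult_Id] DERIV_cmult[OF d2]] d1]]) (simp add: diff_divide_distrib algebra_simps)
    moreover have "- (K - 2) * (K + 1) + (K - 2) * (K * e) + (K - 2) / e
       = - ((K - 2) * (1 - e) * (K * e - 1) / e)" using e1 by (simp add: field_simps)
    moreover have "0 \<le> (K - 2) * (1 - e) * (K * e - 1) / e"
      using e e1 by (intro divide_nonneg_nonneg mult_nonneg_nonneg) (auto simp: K[symmetric])
    ultimately show "\<exists>y. (D has_real_derivative y) (at x) \<and> y \<le> 0" by fastforce
  qed
  moreover have "D 1 = 0" by (simp add: D_def power2_eq_square algebra_simps)
  ultimately have "0 \<le> u ^ (j + 1) * D u" using assms by simp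
  also have "u ^ (j + 1) * D u = (K - 1)\<^sup>2 * u ^ (j + 1) - (K - 2) * (K + 1) * u * u ^ (j + 1)
     + (K - 2) * u * (u ^ (j + 1))\<^sup>2 - u"
    using assms by (simp add: D_def field_simps power2_eq_square)
  finally show ?thesis by (simp add: k K_def power2_eq_square algebra_simps)
qed

lemma excess_nonneg:
  assumes "k \<ge> 2" "t \<le> 1"
  shows "0 \<le> excess k t"
  using psi_le_self[OF assms] by (simp add: excess_def)

lemma excess_bulk_ratio_antimono:
  assumes "k \<ge> 2" "admissible k t" "0 < x" "x \<le> t"
  shows "excess k t / bulk k t ^ k \<le> excess k x / bulk k x ^ k"
proof (rule DERIV_nonpos_imp_nonincreasing[OF \<open>x \<le> t\<close>])
  fix s assume s: "x \<le> s" "s \<le> t"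
  have adm: "admissible k s" using admissible_antimono[OF assms(1,2)] s assms by simp
  have s01: "0 < s" "s \<le> 1 / 2" using s assms admissible_le_half[OF assms(1) adm] by auto
  define u where "u = 1 - s"
  define e where "e = u ^ (k - 1)"
  define K where "K = real k"
  define S where "S = excess k s"
  define Y where "Y = bulk k s"
  define P' where "P' = (K * e - 1) / (K - 1)"
  have K: "2 \<le> K" using assms by (simp add: K_def)
  have ue: "u ^ k = u * e" using assms by (simp add: e_def power_eq_if[of _ k])
  have Y0: "0 < Y" using le_bulk[OF assms(1), of s] s01 by (simp add: Y_def)
  have dpsi: "(psi k has_real_derivative P') (at s)"
    using has_derivative_psi[OF assms(1), of s] by (simp add: P'_def e_def u_def K_def)
  have dS: "(excess k has_real_derivative (1 - P')) (at s)"
    unfolding excess_def[abs_def] by (auto intro!: derivative_eq_intros dpsi)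
  have dY: "(bulk k has_real_derivative (1 + (K - 2) * P')) (at s)"
    unfolding bulk_def[abs_def] K_def by (auto intro!: derivative_eq_intros dpsi)
  have "((\<lambda>s. excess k s / bulk k s ^ k) has_real_derivative
     ((1 - P') * Y ^ k - S * (K * (1 + (K - 2) * P') * Y ^ (k - 1))) / (Y ^ k * Y ^ k)) (at s)"
    using Y0 by (auto intro!: derivative_eq_intros dS dY simp: S_def Y_def K_def mult_ac)
  moreover have "((1 - P') * Y ^ k - S * (K * (1 + (K - 2) * P') * Y ^ (k - 1))) / (Y ^ k * Y ^ k) \<le> 0"
  proof -
    have KS: "(K - 1) * S = K - 1 - K * u + u * e"
      using excess_mult[OF assms(1), of s] by (simp add: K_def S_def ue[symmetric]) (simp add: u_def)
    have Ys: "Y = (K - 1) * (1 - u) - (K - 2) * S"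
      by (simp add: Y_def S_def bulk_def excess_def K_def u_def algebra_simps)
    have KP: "(K - 1) * P' = K * e - 1" using K by (simp add: P'_def)
    have "u * (1 - e)\<^sup>2 \<le> (K - 1) * e * (K - 1 - K * u + u ^ k)"
      unfolding e_def K_def using admissible_slope[OF assms(1) adm] assms(1) s01
      by (intro excess_bulk_slope) (auto simp: u_def)
    then have main: "u * (1 - e)\<^sup>2 \<le> (K - 1) * e * ((K - 1) * S)"
      unfolding KS ue .
    have "(K - 1) * ((1 - P') * Y - S * (K * (1 + (K - 2) * P')))
      = (K - 1 - (K - 1) * P') * Y - S * K * ((K - 1) + (K - 2) * ((K - 1) * P'))"
      by (simp add: algebra_simps)
    also have "\<dots> = K * (1 - e) * Y - S * K * (1 + K * (K - 2) * e)"
      unfolding KP by (simp add: algebra_simps)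
    also have "\<dots> = K * ((1 - e) * ((K - 1) * (1 - u)) - (K - 1) * S * (1 + (K - 2) * e))"
      unfolding Ys by (simp add: algebra_simps)
    also have "(1 - e) * ((K - 1) * (1 - u)) - (K - 1) * S * (1 + (K - 2) * e)
        = u * (1 - e)\<^sup>2 - (K - 1) * e * ((K - 1) * S)"
      unfolding KS by (simp add: algebra_simps power2_eq_square)
    also have "K * \<dots> \<le> 0" using main K by (simp add: mult_nonneg_nonpos)
    finally have "(1 - P') * Y - S * (K * (1 + (K - 2) * P')) \<le> 0"
      using K by (simp add: mult_le_0_iff)
    then have "Y ^ (k - 1) * ((1 - P') * Y - S * (K * (1 + (K - 2) * P'))) \<le> 0"
      using Y0 by (intro mult_nonneg_nonpos) auto
    also have "Y ^ (k - 1) * ((1 - P') * Y - S * (K * (1 + (K - 2) * P')))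
        = (1 - P') * Y ^ k - S * (K * (1 + (K - 2) * P') * Y ^ (k - 1))"
      using assms by (simp add: power_eq_if[of Y k] algebra_simps)
    finally show ?thesis using Y0 by (intro divide_nonpos_pos) auto
  qed
  ultimately show "\<exists>y. ((\<lambda>s. excess k s / bulk k s ^ k) has_real_derivative y) (at s) \<and> y \<le> 0"
    by blast
qed

lemma continuous_on_psi: "continuous_on A (psi k)"
  unfolding psi_def[abs_def] divide_inverse by (intro continuous_intros)

text \<open>Equality holds at the largest admissible value, where \<open>t + bulk k t = 1\<close>; monotonicity of the
ratio carries the inequality down to smaller values.\<close>

lemma bulk_power_le_excess:
  assumes "k \<ge> 2" "admissible k t"
  shows "bulk k t ^ k \<le> excess k t"
proof (cases "t = 0")
  case True
  then show ?thesis using assms by (simp add: bulk_def excess_def power_0_left)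
next
  case False
  then have t: "0 < t" "t \<le> 1 / 2" using assms admissible_le_half[OF assms] by (auto simp: admissible_def)
  have "\<exists>c\<ge>t. c \<le> 1 / 2 \<and> c + bulk k c = 1"
  proof (rule IVT')
    show "t + bulk k t \<le> 1" using assms by (simp add: admissible_def)
    show "1 \<le> 1 / 2 + bulk k (1 / 2)" using le_bulk[OF assms(1), of "1 / 2"] by simp
    show "continuous_on {t..1 / 2} (\<lambda>c. c + bulk k c)"
      unfolding bulk_def by (intro continuous_intros continuous_on_psi)
  qed (use t in auto)
  then obtain c where c: "t \<le> c" "c \<le> 1 / 2" "c + bulk k c = 1" by blast
  have adm: "admissible k c" using c t by (simp add: admissible_def)
  have "1 - c = bulk k c" using c(3) by simp
  then have "excess k c = bulk k c ^ k"
    using bulk_alt[OF assms(1), of c] by simp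
  moreover have "0 < bulk k c" using c by simp
  ultimately have "1 \<le> excess k t / bulk k t ^ k"
    using excess_bulk_ratio_antimono[OF assms(1) adm t(1) c(1)] by simp
  moreover have "0 < bulk k t" using le_bulk[of k t] assms t by simp
  ultimately show ?thesis by (simp add: field_simps)
qed

text \<open>This serves a law with floor \<open>l\<close> whose largest atom \<open>x\<close> is known to satisfy \<open>psi k x \<le> l\<close>: the
same then holds for every smaller value \<open>r\<close> that a further atom reaches. The function \<open>psi k\<close> is not
monotone, so \<open>r \<le> x\<close> alone does not give this. If \<open>psi k r > l\<close>, concavity keeps \<open>psi k\<close> above
\<open>l\<close> between \<open>r\<close> and a point \<open>z\<close> with \<open>psi k z \<ge> psi k r\<close>, and above the segment from
\<open>(z, psi k r)\<close> to \<open>(1 - r, 0)\<close> after that; the mass constraint places \<open>(x, l)\<close> on or below this segment.\<close>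

lemma psi_le_reflect:
  assumes "k \<ge> 3" "psi k x \<le> l" "0 \<le> r" "r \<le> x" "x \<le> 1" "x + r + (real k - 2) * l \<le> 1"
  shows "psi k r \<le> l"
proof (rule ccontr)
  assume "\<not> ?thesis"
  then have l: "l < psi k r" by simp
  have k: "k \<ge> 2" using assms by simp
  have conc: "(1 - a) * psi k y + a * psi k z \<le> psi k ((1 - a) * y + a * z)"
    if "0 \<le> a" "a \<le> 1" "0 \<le> y" "y \<le> 1" "0 \<le> z" "z \<le> 1" for a y z
    using concave_onD[OF concave_psi[OF k], of a y z] that by simp
  have x: "0 \<le> x" "x \<le> 1" using assms by auto
  have l0: "0 \<le> l" using psi_nonneg[OF k x] assms by linarith
  have "0 \<le> (real k - 2) * l" using l0 assms(1) by simp
  then have xr: "x \<le> 1 - r" using assms(6) by linarith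
  have r: "0 < r" "r < 1"
  proof -
    show "0 < r" using l l0 assms(3) by (cases "r = 0") auto
    then show "r < 1" using xr x assms by linarith
  qed
  \<comment> \<open>For admissible \<open>r\<close> the point \<open>1 - bulk k r\<close> works by \<open>bulk_power_le_excess\<close>; otherwise \<open>r\<close> itself is already far enough to the right.\<close>
  obtain z where z: "r \<le> z" "z \<le> 1 - r" "psi k r \<le> psi k z" "1 - z - r \<le> (real k - 2) * psi k r"
  proof (cases "admissible k r")
    case True
    show ?thesis
    proof (rule that[of "1 - bulk k r"])
      show "r \<le> 1 - bulk k r" using True by (simp add: admissible_def)
      show "1 - bulk k r \<le> 1 - r" using le_bulk[OF k] r by simp
      show "1 - (1 - bulk k r) - r \<le> (real k - 2) * psi k r" by (simp add: bulk_def)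
      have "(real k - 1) * psi k (1 - bulk k r) = bulk k r - bulk k r ^ k"
        by (simp add: psi_mult[OF k])
      moreover have "(real k - 1) * psi k r = bulk k r - excess k r"
        by (simp add: bulk_def excess_def algebra_simps)
      ultimately have "(real k - 1) * psi k r \<le> (real k - 1) * psi k (1 - bulk k r)"
        using bulk_power_le_excess[OF k True] by linarith
      then show "psi k r \<le> psi k (1 - bulk k r)" using k by simp
    qed
  next
    case False
    then show ?thesis using r xr assms(4) by (intro that[of r]) (auto simp: admissible_def bulk_def)
  qed
  show False
  proof (cases "x \<le> z")
    case True
    show False
    proof (cases "r = z")
      case True
      then have "x = r" using \<open>x \<le> z\<close> assms by simp
      then show False using l assms by simp
    next
      case False
      define a where "a = (x - r) / (z - r)"
      have zr: "z - r > 0" using z False by simp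
      have a: "0 \<le> a" "a \<le> 1" using assms zr True by (auto simp: a_def)
      have "a * (z - r) = x - r" using zr by (simp add: a_def)
      then have "(1 - a) * r + a * z = x" by (simp add: algebra_simps)
      then have "(1 - a) * psi k r + a * psi k z \<le> psi k x" using conc[of a r z] a r z by simp
      moreover have "a * psi k r \<le> a * psi k z" using a z by (intro mult_left_mono) auto
      ultimately have "psi k r \<le> psi k x" by (simp add: algebra_simps)
      then show False using l assms by linarith
    qed
  next
    case False
    define a where "a = (x - z) / (1 - r - z)"
    have zr: "1 - r - z > 0" using xr False by simp
    have a: "0 < a" "a \<le> 1" using zr False xr by (auto simp: a_def)
    have ax: "a * (1 - r - z) = x - z" using zr by (simp add: a_def)
    then have "(1 - a) * z + a * (1 - r) = x" by (simp add: algebra_simps)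
    then have 1: "(1 - a) * psi k z + a * psi k (1 - r) \<le> psi k x"
      using conc[of a z "1 - r"] a r z by simp
    have 2: "0 < a * psi k (1 - r)" using psi_pos[OF k, of "1 - r"] r a by simp
    have "(1 - a) * psi k r \<le> (1 - a) * psi k z" using a z by (intro mult_left_mono) auto
    then have 3: "(1 - a) * psi k r < l" using 1 2 assms(2) by linarith
    have "(real k - 2) * l \<le> 1 - x - r" using assms by linarith
    also have "\<dots> = (1 - a) * (1 - z - r)" using ax by (simp add: algebra_simps)
    also have "\<dots> \<le> (1 - a) * ((real k - 2) * psi k r)"
      using a z by (intro mult_left_mono) auto
    finally have "(real k - 2) * l \<le> (real k - 2) * ((1 - a) * psi k r)" by (simp add: mult_ac)
    then have "l \<le> (1 - a) * psi k r" using assms(1) by simp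
    then show False using 3 by simp
  qed
qed

text \<open>The function \<open>excess k s\<close> equals \<open>s\<^sup>2\<close> times a polynomial in \<open>1 - s\<close> with nonnegative
coefficients, hence \<open>excess k s / s\<^sup>2\<close> decreases in \<open>s\<close>.\<close>

lemma excess_quadratic:
  assumes "k \<ge> 2" "0 \<le> x" "x \<le> t" "t \<le> 1"
  shows "x\<^sup>2 * excess k t \<le> t\<^sup>2 * excess k x"
proof -
  have eq: "(real k - 1) * excess k s = s\<^sup>2 * (\<Sum>i<k. \<Sum>j<i. (1 - s) ^ j)" for s
  proof -
    have "(real k - 1) * excess k s = (real k - (\<Sum>i<k. (1 - s) ^ i)) * s"
      using one_diff_power_eq[of "1 - s" k] unfolding excess_mult[OF assms(1)]
      by (simp add: algebra_simps)
    also have "real k - (\<Sum>i<k. (1 - s) ^ i) = (\<Sum>i<k. 1 - (1 - s) ^ i)"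
      by (simp add: sum_subtractf)
    also have "\<dots> = (\<Sum>i<k. s * (\<Sum>j<i. (1 - s) ^ j))"
      by (simp add: one_diff_power_eq)
    finally show ?thesis by (simp add: sum_distrib_left power2_eq_square mult_ac)
  qed
  have "(\<Sum>i<k. \<Sum>j<i. (1 - t) ^ j) \<le> (\<Sum>i<k. \<Sum>j<i. (1 - x) ^ j)"
    using assms by (intro sum_mono power_mono) auto
  then have "x\<^sup>2 * t\<^sup>2 * (\<Sum>i<k. \<Sum>j<i. (1 - t) ^ j) \<le> x\<^sup>2 * t\<^sup>2 * (\<Sum>i<k. \<Sum>j<i. (1 - x) ^ j)"
    by (intro mult_left_mono) auto
  then have "x\<^sup>2 * ((real k - 1) * excess k t) \<le> t\<^sup>2 * ((real k - 1) * excess k x)"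
    unfolding eq by (simp add: mult_ac)
  then have "(real k - 1) * (x\<^sup>2 * excess k t) \<le> (real k - 1) * (t\<^sup>2 * excess k x)"
    by (simp add: mult_ac)
  then show ?thesis using assms by simp
qed

section \<open>The oscillation of a law with peak at zero\<close>

text \<open>The ratio \<open>psi k t / t\<close> is the arithmetic mean of \<open>(1 - t) ^ j\<close> over \<open>1 \<le> j \<le> k - 1\<close>.\<close>

lemma psi_eq_sum:
  assumes "k \<ge> 2"
  shows "(real k - 1) * psi k t = t * (\<Sum>i<k - 1. (1 - t) ^ Suc i)"
proof -
  have "(1 - t) ^ k = (1 - t) * (1 - t) ^ (k - 1)"
    using assms by (simp add: power_eq_if[of _ k])
  then have "(real k - 1) * psi k t = (1 - t) * (1 - (1 - t) ^ (k - 1))"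
    unfolding psi_mult[OF assms] by (simp only: algebra_simps mult_1_right)
  also have "\<dots> = (1 - t) * (t * (\<Sum>i<k - 1. (1 - t) ^ i))"
    by (simp add: one_diff_power_eq)
  finally show ?thesis by (simp add: sum_distrib_left mult_ac)
qed

lemma psi_ratio_antimono:
  assumes "k \<ge> 2" "0 < x" "x \<le> t" "t \<le> 1"
  shows "psi k t / t \<le> psi k x / x"
proof -
  have "(\<Sum>i<k - 1. (1 - t) ^ Suc i) \<le> (\<Sum>i<k - 1. (1 - x) ^ Suc i)"
    using assms by (intro sum_mono power_mono) auto
  then have "(real k - 1) * (psi k t / t) \<le> (real k - 1) * (psi k x / x)"
    using assms psi_eq_sum[OF assms(1), of t] psi_eq_sum[OF assms(1), of x] by simp
  then show ?thesis by (rule mult_left_le_imp_le) (use assms in simp)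
qed

text \<open>Pairing the exponents \<open>j\<close> and \<open>k - j\<close> of the mean gives the first bound by the inequality of
arithmetic and geometric means, and the second one by Bernoulli's inequality.\<close>

lemma psi_ratio_bounds:
  assumes "k \<ge> 2" "0 < t" "t \<le> 1"
  defines "c \<equiv> psi k t / t"
  shows "sqrt ((1 - t) ^ k) \<le> c" "1 - real k * t / 2 \<le> c"
proof -
  define u where "u = 1 - t"
  have u: "0 \<le> u" "u \<le> 1" using assms by (auto simp: u_def)
  have kc: "(real k - 1) * c = (\<Sum>i<k - 1. u ^ Suc i)"
    using psi_eq_sum[OF assms(1), of t] assms by (simp add: c_def u_def)
  have "(\<Sum>i<k - 1. u ^ Suc i) = (\<Sum>i<k - 1. u ^ Suc (k - 1 - Suc i))"
    by (rule sum.nat_diff_reindex[symmetric])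
  then have pairs: "2 * ((real k - 1) * c) = (\<Sum>i<k - 1. u ^ Suc i + u ^ Suc (k - 1 - Suc i))"
    unfolding kc by (simp add: sum.distrib)
  have "(\<Sum>i<k - 1. 2 * sqrt (u ^ k)) \<le> 2 * ((real k - 1) * c)" unfolding pairs
  proof (rule sum_mono)
    fix i assume "i \<in> {..<k - 1}"
    then have "u ^ Suc i * u ^ Suc (k - 1 - Suc i) = u ^ k" 
      unfolding power_add[symmetric] by (intro arg_cong[of _ _ "(^) u"]) auto
    then show "2 * sqrt (u ^ k) \<le> u ^ Suc i + u ^ Suc (k - 1 - Suc i)"
      using arith_geo_mean_sqrt[of "u ^ Suc i" "u ^ Suc (k - 1 - Suc i)"] u by simp
  qed
  then have "(real k - 1) * sqrt (u ^ k) \<le> (real k - 1) * c" using assms by (simp add: of_nat_diff)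
  then have "sqrt (u ^ k) \<le> c" by (rule mult_left_le_imp_le) (use assms in simp)
  then show "sqrt ((1 - t) ^ k) \<le> c" by (simp add: u_def)
  have "(\<Sum>i<k - 1. 2 - real k * t) \<le> 2 * ((real k - 1) * c)" unfolding pairs
  proof (rule sum_mono)
    fix i assume i: "i \<in> {..<k - 1}"
    have b: "1 - real j * t \<le> u ^ j" for j
      using Bernoulli_inequality[of "- t" j] assms by (simp add: u_def)
    have "real (Suc i) + real (Suc (k - 1 - Suc i)) = real k" using i by (simp flip: of_nat_add)
    then have "real (Suc i) * t + real (Suc (k - 1 - Suc i)) * t = real k * t"
      by (simp only: distrib_right[symmetric])
    then show "2 - real k * t \<le> u ^ Suc i + u ^ Suc (k - 1 - Suc i)"
      using b[of "Suc i"] b[of "Suc (k - 1 - Suc i)"] by linarith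
  qed
  then have "(real k - 1) * (2 - real k * t) \<le> (real k - 1) * (2 * c)"
    using assms by (simp add: of_nat_diff mult_ac)
  then have "2 - real k * t \<le> 2 * c" by (rule mult_left_le_imp_le) (use assms in simp)
  then show "1 - real k * t / 2 \<le> c" by simp
qed

lemma power_le_psi_ratio:
  assumes "k \<ge> 2" "0 < t" "t \<le> 1"
  shows "(1 - t) ^ k \<le> (1 - t) * (psi k t / t)"
proof -
  define u where "u = 1 - t"
  have u: "0 \<le> u" "u \<le> 1" using assms by (auto simp: u_def)
  have "(\<Sum>i<k - 1. u ^ (k - 1)) \<le> (\<Sum>i<k - 1. u ^ Suc i)"
    using u by (intro sum_mono power_decreasing) auto
  also have "\<dots> = (real k - 1) * (psi k t / t)"
    using psi_eq_sum[OF assms(1), of t] assms by (simp add: u_def)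
  finally have "(real k - 1) * u ^ (k - 1) \<le> (real k - 1) * (psi k t / t)"
    using assms by (simp add: of_nat_diff)
  then have "u ^ (k - 1) \<le> psi k t / t" by (rule mult_left_le_imp_le) (use assms in simp)
  then have "u * u ^ (k - 1) \<le> u * (psi k t / t)" using u by (intro mult_left_mono)
  then show ?thesis using assms by (simp add: u_def power_eq_if[of _ k])
qed

lemma self_le_square_plus:
  fixes y :: real
  assumes "0 \<le> y" "y * (1 - y) \<le> a"
  shows "y\<^sup>2 \<le> (a + y\<^sup>2)\<^sup>2"
  using assms by (intro power_mono) (auto simp: power2_eq_square algebra_simps)

text \<open>Let \<open>c = psi k t / t\<close> and let \<open>a\<close> be the first summand on the right. Here \<open>b\<close> is the oscillation
mass of a law with peak at zero: the peak is at least \<open>t\<close>, which gives the first upper bound on \<open>b\<close>,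
and each of the other \<open>k - 1\<close> atoms is at most \<open>t\<close>, which gives the second. With \<open>y = sqrt b\<close> the claim becomes
\<open>y * (1 - y) \<le> a\<close>. One always has \<open>y \<le> c\<close> and \<open>c * (1 - c) \<le> a\<close>, which settles
\<open>c \<le> 1 / 2\<close>. For larger \<open>c\<close> the bound \<open>X = (k - 1) * excess k t\<close> on \<open>b\<close> is used: either
\<open>a \<ge> 1 / 4\<close>, or \<open>X \<le> 1 / 4\<close> and the claim for \<open>X\<close> in place of \<open>b\<close> reduces to
\<open>8 * k * (k - 1) \<le> (3 * k - 2)\<^sup>2\<close>; it passes to \<open>b\<close> because \<open>y * (1 - y)\<close> increases on
\<open>[0, 1 / 2]\<close>.\<close>

lemma smoothing_quadratic:
  assumes "k \<ge> 4" "0 < t" "t \<le> 1" "0 \<le> b" "b \<le> (1 - t) ^ k" "b \<le> (real k - 1) * excess k t"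
  shows "b \<le> (psi k t * (1 + (real k - 2) * (psi k t / t)) + b)\<^sup>2"
proof -
  define K c a X y where "K = real k" and "c = psi k t / t"
    and "a = psi k t * (1 + (K - 2) * c)" and "X = (K - 1) * ((1 - c) * t)" and "y = sqrt b"
  have k: "k \<ge> 2" and K: "K \<ge> 4" using assms by (auto simp: K_def)
  have ct: "psi k t = c * t" using assms by (simp add: c_def)
  have c0: "0 \<le> c" using psi_nonneg[OF k, of t] assms by (simp add: c_def)
  have c1: "c \<le> 1" using psi_le_self[OF k, of t] assms by (simp add: c_def)
  have id: "(K - 1) * (c * t) = 1 - t - (1 - t) ^ k"
    using psi_mult[OF k, of t] by (simp add: ct K_def)
  have bX: "b \<le> X" using assms by (simp add: X_def excess_def ct K_def algebra_simps)
  have y: "0 \<le> y" "y\<^sup>2 = b" using assms by (auto simp: y_def)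
  have "a = c * (t + ((K - 1) * (c * t) - c * t))" by (simp add: a_def ct algebra_simps)
  also have "\<dots> = c * (1 - ((1 - t) ^ k + c * t))" unfolding id by (simp add: algebra_simps)
  also have "\<dots> \<ge> c * (1 - c)"
    using power_le_psi_ratio[OF k assms(2,3)] c0
    by (intro mult_left_mono) (auto simp: c_def[symmetric] algebra_simps)
  finally have a_ge: "c * (1 - c) \<le> a" .
  have yc: "y \<le> c"
    using psi_ratio_bounds(1)[OF k assms(2,3)] real_sqrt_le_mono[OF assms(5)]
    unfolding y_def c_def by linarith
  have Kt: "2 * (1 - c) \<le> K * t"
    using psi_ratio_bounds(2)[OF k assms(2,3)] by (simp add: c_def K_def)
  have "y * (1 - y) \<le> a"
  proof (cases "c \<le> 1 / 2 \<or> 1 / 4 \<le> a")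
    case True
    then show ?thesis
    proof
      assume "c \<le> 1 / 2"
      then have "0 \<le> (c - y) * (1 - c - y)" using yc by (intro mult_nonneg_nonneg) auto
      then show ?thesis using a_ge by (simp add: algebra_simps)
    next
      assume "1 / 4 \<le> a"
      moreover have "0 \<le> (y - 1 / 2)\<^sup>2" by simp
      ultimately show ?thesis by (simp add: power2_eq_square algebra_simps)
    qed
  next
    case False
    then have c: "1 / 2 < c" and a: "a < 1 / 4" by auto
    \<comment> \<open>The constant \<open>62 / 100\<close> is chosen just above the root of \<open>c\<^sup>2 = 1 - c\<close>; on \<open>[1 / 2, 62 / 100]\<close> the product \<open>c * (1 - c) * (1 + 2 * c)\<close> is at least \<open>1 / 2\<close>.\<close>
    have c62: "62 / 100 < c"
    proof (rule ccontr)
      assume "\<not> ?thesis"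
      then have "0 \<le> (c - 1 / 2) * (62 / 100 - c)" using c by simp
      \<comment> \<open>\<open>c * (1 - c) * (1 + 2 * c) - 1 / 2\<close> is a combination of this product and \<open>c - 1 / 2\<close> with nonnegative coefficients.\<close>
      then have p: "0 \<le> - (c * c) + 112 / 100 * c - 31 / 100" by (simp add: field_simps)
      then have "0 \<le> c * (- (c * c) + 112 / 100 * c - 31 / 100)" using c0 by simp
      then have "1 / 2 \<le> c * (1 - c) * (1 + 2 * c)" using p c by (simp add: algebra_simps)
      have "0 \<le> (K - 4) * (2 * c - 1)" using K c by simp
      then have "K * (1 + 2 * c) \<le> 4 * (1 + (K - 2) * c)" by (simp add: algebra_simps)
      have "c * (1 + (K - 2) * c) * (2 * (1 - c)) \<le> c * (1 + (K - 2) * c) * (K * t)"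
        using Kt c0 K by (intro mult_left_mono) auto
      also have "\<dots> = K * a" by (simp add: a_def ct)
      finally have "c * (1 - c) * (4 * (1 + (K - 2) * c)) \<le> 2 * K * a" by (simp add: algebra_simps)
      moreover have "c * (1 - c) * (K * (1 + 2 * c)) \<le> c * (1 - c) * (4 * (1 + (K - 2) * c))"
        using \<open>K * (1 + 2 * c) \<le> _\<close> c0 c1 by (intro mult_left_mono) auto
      moreover have "K * (1 / 2) \<le> K * (c * (1 - c) * (1 + 2 * c))"
        using \<open>1 / 2 \<le> _\<close> K by (intro mult_left_mono) auto
      moreover have "K * (c * (1 - c) * (1 + 2 * c)) = c * (1 - c) * (K * (1 + 2 * c))" by simp
      ultimately have "K * (1 / 2) \<le> 2 * K * a" by linarith
      then have "K * (1 / 2) \<le> K * (2 * a)" by simp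
      then have "1 / 2 \<le> 2 * a" using K by simp
      then show False using a by simp
    qed
    have X: "X \<le> 1 / 4"
    proof (rule ccontr)
      assume X: "\<not> ?thesis"
      then have "c \<noteq> 1" by (auto simp: X_def)
      then have c1': "0 < 1 - c" using c1 by simp
      have "(K - 1) * c \<le> 1 + (K - 2) * c" using c1 by (simp add: algebra_simps)
      then have "c * X * ((K - 1) * c) \<le> c * X * (1 + (K - 2) * c)"
        using c0 X by (intro mult_left_mono) auto
      also have "\<dots> = (K - 1) * (a * (1 - c))" by (simp add: a_def ct X_def)
      finally have "(K - 1) * (c * c * X) \<le> (K - 1) * (a * (1 - c))" by (simp add: mult_ac)
      then have "c * c * X \<le> a * (1 - c)" using K by simp
      have "c * c * (1 / 4) \<le> c * c * X" using X by (intro mult_left_mono) auto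
      also note \<open>c * c * X \<le> a * (1 - c)\<close>
      also have "a * (1 - c) \<le> 1 / 4 * (1 - c)" using a c1 by (intro mult_right_mono) auto
      finally have "c * c \<le> 1 - c" by simp
      moreover have "62 / 100 * (62 / 100) \<le> c * c" using c62 by (intro mult_mono) auto
      ultimately show False using c62 by simp
    qed
    define z where "z = sqrt X"
    have z: "0 \<le> z" "y \<le> z" "z\<^sup>2 = X"
      using bX assms(4) by (auto simp: z_def y_def)
    have "z \<le> sqrt ((1 / 2)\<^sup>2)"
      unfolding z_def using X by (intro real_sqrt_le_mono) (simp add: power2_eq_square)
    then have "z \<le> 1 / 2" by simp
    note z = z this
    have aX: "a + X = t * ((K - 1) - (K - 2) * (c * (1 - c)))"
      by (simp add: a_def X_def ct algebra_simps)
    have "0 \<le> (c - 1 / 2)\<^sup>2" by simp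
    then have "c * (1 - c) \<le> 1 / 4" by (simp add: power2_eq_square algebra_simps)
    then have "(K - 2) * (c * (1 - c)) \<le> (K - 2) * (1 / 4)" using K by (intro mult_left_mono) auto
    then have "t * ((3 * K - 2) / 4) \<le> a + X"
      unfolding aX using assms by (intro mult_left_mono) auto
    then have "(t * ((3 * K - 2) / 4))\<^sup>2 \<le> (a + X)\<^sup>2" using assms K by (intro power_mono) auto
    moreover have "X \<le> (K - 1) * (K * t / 2 * t)"
      unfolding X_def using Kt K assms by (intro mult_left_mono mult_right_mono) auto
    moreover have "(K - 1) * (K * t / 2 * t) \<le> (t * ((3 * K - 2) / 4))\<^sup>2"
    proof -
      have "(t * ((3 * K - 2) / 4))\<^sup>2 = (K - 1) * (K * t / 2 * t) + (t * (K - 2))\<^sup>2 / 16"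
        by (simp add: power2_eq_square field_simps)
      then show ?thesis by simp
    qed
    ultimately have "z\<^sup>2 \<le> (a + X)\<^sup>2" using z by linarith
    moreover have "0 \<le> c * (1 - c)" using c0 c1 by simp
    then have "0 \<le> a + X" using a_ge bX assms(4) by linarith
    ultimately have "z \<le> a + X" by (rule power2_le_imp_le)
    then have "z * (1 - z) \<le> a" using z by (simp add: power2_eq_square algebra_simps)
    moreover have "0 \<le> (z - y) * (1 - z - y)" using z by (intro mult_nonneg_nonneg) auto
    ultimately show ?thesis by (simp add: algebra_simps)
  qed
  then have "y\<^sup>2 \<le> (a + y\<^sup>2)\<^sup>2" by (rule self_le_square_plus[OF y(1)])
  then show ?thesis unfolding y(2) a_def c_def K_def .
qed

section \<open>Floors of products\<close>

text \<open>Here \<open>P\<close> is the mass off zero of a law with peak at zero, and \<open>n\<close>, \<open>b\<close> are the floor and the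
oscillation mass off zero of the other factor, whose mass off zero is \<open>Q = (k - 1) * n + b\<close>.
If the value \<open>R = n * P + b * t\<close> violated the claim, then \<open>bulk k R \<ge> Q * bulk k t\<close> while
\<open>excess k R < b * excess k t \<le> Q ^ k * excess k t\<close>, against \<open>excess_bulk_ratio_antimono\<close>.\<close>

lemma psi_le_mixture:
  assumes "k \<ge> 2" "admissible k t" "0 \<le> b" "0 \<le> n" "bulk k t \<le> P"
    and "b \<le> ((real k - 1) * n + b) ^ k" "n * P + b * t \<le> t"
  shows "psi k (n * P + b * t) \<le> n * P + b * psi k t"
proof (rule ccontr)
  define R Q where "R = n * P + b * t" and "Q = (real k - 1) * n + b"
  assume "\<not> ?thesis"
  then have gt: "n * P + b * psi k t < psi k R" by (simp add: R_def)
  have t: "0 \<le> t" "t \<le> 1" using assms by (auto simp: admissible_def)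
  have bt: "0 \<le> bulk k t" using bulk_nonneg assms t by simp
  have R0: "0 \<le> R" using assms t bt by (simp add: R_def)
  have "0 \<le> n * P + b * psi k t" using psi_nonneg[OF assms(1) t] assms bt by simp
  then have "R \<noteq> 0" using gt by auto
  then have R: "0 < R" "R \<le> t" using R0 assms by (auto simp: R_def)
  have bt': "0 < bulk k t" using le_bulk[OF assms(1) t] R by linarith
  have bR: "0 < bulk k R" using le_bulk[OF assms(1), of R] R t by linarith
  have Q0: "0 \<le> Q" using assms by (simp add: Q_def)
  have "Q * bulk k t = (real k - 1) * n * bulk k t + b * bulk k t" by (simp add: Q_def algebra_simps)
  also have "\<dots> \<le> (real k - 1) * n * P + b * bulk k t"
    using assms by (intro add_right_mono mult_left_mono) auto
  also have "\<dots> = R + (real k - 2) * (n * P + b * psi k t)" by (simp add: R_def bulk_def algebra_simps)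
  also have "\<dots> \<le> bulk k R"
    unfolding bulk_def using gt assms by (intro add_left_mono mult_left_mono) auto
  finally have "(Q * bulk k t) ^ k \<le> bulk k R ^ k" using Q0 bt by (intro power_mono) auto
  then have "b * bulk k t ^ k \<le> bulk k R ^ k"
    using mult_right_mono[OF assms(6), of "bulk k t ^ k"] bt by (simp add: Q_def power_mult_distrib)
  then have "b * bulk k t ^ k * excess k t \<le> bulk k R ^ k * excess k t"
    using excess_nonneg[OF assms(1) t(2)] by (rule mult_right_mono)
  also have "\<dots> \<le> excess k R * bulk k t ^ k"
    using excess_bulk_ratio_antimono[OF assms(1,2) R] bt' bR by (simp add: field_simps)
  finally have "(b * excess k t) * bulk k t ^ k \<le> excess k R * bulk k t ^ k" by (simp add: mult_ac)
  then have "b * excess k t \<le> excess k R" using bt' by simp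
  then show False using gt by (simp add: excess_def R_def algebra_simps)
qed

text \<open>The variant for a second factor that also has its peak at zero, where \<open>b\<close> need not be bounded by
the \<open>k\<close>-th power of the mass. Since \<open>t \<le> t'\<close>, the ratio \<open>psi k t / t\<close> is at least
\<open>psi k t' / t'\<close>, so the value \<open>R\<close> is at least \<open>t\<close> times the base of the square in
\<open>smoothing_quadratic\<close> for \<open>t'\<close>, and \<open>excess_quadratic\<close> yields \<open>excess k R \<ge> b * excess k t\<close>.\<close>

lemma psi_le_mixture_of_dispersed:
  assumes "k \<ge> 4" "admissible k t" "admissible k t'" "t \<le> t'" "0 \<le> b" "bulk k t \<le> P"
    and "b \<le> (1 - t') ^ k" "b \<le> (real k - 1) * excess k t'" "psi k t' * P + b * t \<le> t"
  shows "psi k (psi k t' * P + b * t) \<le> psi k t' * P + b * psi k t"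
proof -
  define n where "n = psi k t'"
  have k: "k \<ge> 2" using assms by simp
  have t: "0 \<le> t" "t \<le> t'" "t' \<le> 1" using assms by (auto simp: admissible_def)
  have n: "0 \<le> n" using psi_nonneg[OF k] t by (simp add: n_def)
  have P: "0 \<le> P" using bulk_nonneg[OF k, of t] t assms by simp
  show ?thesis
  proof (cases "t = 0")
    case True
    then have "n * P + b * t = 0" using assms mult_nonneg_nonneg[OF n P] by (simp add: n_def[symmetric])
    then show ?thesis unfolding n_def[symmetric] using True by (auto simp: mult_eq_0_iff)
  next
    case False
    then have t0: "0 < t" using t by simp
    define R c c' where "R = n * P + b * t" and "c = psi k t / t" and "c' = psi k t' / t'"
    have cc: "c' \<le> c" unfolding c_def c'_def using psi_ratio_antimono[OF k t0] t by simp
    have c'0: "0 \<le> c'" using n t t0 by (simp add: c'_def n_def)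
    have R: "R \<le> t" using assms by (simp add: R_def n_def)
    have "b \<le> (n * (1 + (real k - 2) * c') + b)\<^sup>2"
      unfolding n_def c'_def using assms t t0 by (intro smoothing_quadratic) auto
    then have "t\<^sup>2 * b \<le> t\<^sup>2 * (n * (1 + (real k - 2) * c') + b)\<^sup>2" by (intro mult_left_mono) auto
    also have "\<dots> = (t * (n * (1 + (real k - 2) * c') + b))\<^sup>2" by (simp add: power_mult_distrib)
    also have "\<dots> \<le> R\<^sup>2"
    proof (intro power_mono)
      have "t * (n * (1 + (real k - 2) * c') + b) \<le> t * (n * (1 + (real k - 2) * c) + b)"
        using t n cc k by (intro mult_left_mono add_right_mono add_left_mono) auto
      also have "\<dots> = n * bulk k t + b * t" using t0 by (simp add: bulk_def c_def algebra_simps)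
      also have "\<dots> \<le> R" unfolding R_def using n assms by (intro add_right_mono mult_left_mono)
      finally show "t * (n * (1 + (real k - 2) * c') + b) \<le> R" .
      show "0 \<le> t * (n * (1 + (real k - 2) * c') + b)" using t n c'0 assms by simp
    qed
    finally have "t\<^sup>2 * b * excess k t \<le> R\<^sup>2 * excess k t"
      using excess_nonneg[OF k, of t] t by (intro mult_right_mono) auto
    also have "\<dots> \<le> t\<^sup>2 * excess k R"
      using n P t assms R by (intro excess_quadratic[OF k]) (auto simp: R_def)
    finally have "t\<^sup>2 * (b * excess k t) \<le> t\<^sup>2 * excess k R" by (simp add: mult_ac)
    then have "b * excess k t \<le> excess k R" using t0 by simp
    then show ?thesis by (simp add: excess_def R_def n_def algebra_simps)
  qed
qed

text \<open>Interpolate: choose masses \<open>P'\<close> between \<open>1 - t\<close> and \<open>P\<close>, and \<open>Q'\<close> between \<open>1 - t'\<close> and \<open>Q\<close>,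
with \<open>P' * Q' = 1 - r\<close>. Then \<open>P' - (k - 1) * m \<le> P' ^ k\<close>, likewise for \<open>Q'\<close>, and
multiplication gives the claim for \<open>P'\<close>, \<open>Q'\<close>; its right-hand side increases in both masses.\<close>

lemma psi_le_product_floor:
  assumes "k \<ge> 2" "admissible k t" "admissible k t'" "1 - t \<le> P" "P \<le> 1" "1 - t' \<le> Q" "Q \<le> 1"
    and "1 - P * Q \<le> r" "r \<le> 1 - (1 - t) * (1 - t')"
  defines "m \<equiv> psi k t" and "n \<equiv> psi k t'"
  shows "psi k r \<le> m * Q + n * P - (real k - 1) * m * n"
proof -
  define K where "K = real k"
  have pos: "0 < 1 - t" "0 < 1 - t'" using admissible_le_half assms by fastforce+
  have mn: "0 \<le> m" "0 \<le> n" using assms by (auto intro!: psi_nonneg simp: admissible_def)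
  obtain P' Q' where PQ: "1 - t \<le> P'" "P' \<le> P" "1 - t' \<le> Q'" "Q' \<le> Q" "P' * Q' = 1 - r"
  proof (cases "1 - r \<le> P * (1 - t')")
    case True
    then show ?thesis using assms pos
      by (intro that[of "(1 - r) / (1 - t')" "1 - t'"]) (auto simp: field_simps)
  next
    case False
    then show ?thesis using assms pos
      by (intro that[of P "(1 - r) / P"]) (auto simp: field_simps)
  qed
  have slack: "0 \<le> p - (K - 1) * psi k s \<and> p - (K - 1) * psi k s \<le> p ^ k"
    if "admissible k s" "1 - s \<le> p" "p \<le> 1" for p s
  proof
    have "0 \<le> (1 - s) ^ k" using that by (simp add: admissible_def)
    then show "0 \<le> p - (K - 1) * psi k s"
      using psi_mult[OF assms(1), of s] that by (simp add: K_def)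
    have "(K - 1) * psi k (1 - p) \<le> (K - 1) * psi k s"
      using that assms(1) by (intro mult_left_mono psi_mono_admissible) (auto simp: K_def)
    then show "p - (K - 1) * psi k s \<le> p ^ k"
      using psi_mult[OF assms(1), of "1 - p"] by (simp add: K_def)
  qed
  have "(P' - (K - 1) * m) * (Q' - (K - 1) * n) \<le> P' ^ k * Q' ^ k"
    using slack[of t P'] slack[of t' Q'] assms PQ by (intro mult_mono) (auto simp: m_def n_def)
  also have "\<dots> = (1 - r) ^ k" by (simp add: PQ flip: power_mult_distrib)
  finally have "(K - 1) * psi k r \<le> P' * Q' - (P' - (K - 1) * m) * (Q' - (K - 1) * n)"
    using psi_mult[OF assms(1), of r] by (simp add: K_def PQ)
  also have "\<dots> = (K - 1) * (m * Q' + n * P' - (K - 1) * m * n)" by (simp add: algebra_simps)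
  finally have "psi k r \<le> m * Q' + n * P' - (K - 1) * m * n" using assms(1) by (simp add: K_def)
  also have "\<dots> \<le> m * Q + n * P - (K - 1) * m * n"
    using PQ mn by (intro diff_right_mono add_mono mult_left_mono)
  finally show ?thesis by (simp add: K_def)
qed

section \<open>Laws and their floors\<close>

text \<open>A point \<open>c\<close> carrying a largest atom, together with the value \<open>t\<close> of the second largest atom, counted with
multiplicity.\<close>

definition peak :: "('a \<Rightarrow> real) \<Rightarrow> 'a \<Rightarrow> real \<Rightarrow> bool" where
  "peak p c t \<longleftrightarrow> t \<le> p c \<and> (\<forall>x. x \<noteq> c \<longrightarrow> p x \<le> t) \<and> (\<exists>x. x \<noteq> c \<and> p x = t)"

definition is_law :: "('a::finite \<Rightarrow> real) \<Rightarrow> bool" where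
  "is_law p \<longleftrightarrow> (\<forall>x. 0 \<le> p x) \<and> (\<Sum>x\<in>UNIV. p x) = 1"

text \<open>Membership in the body, with a witness for the peak and the value of the second atom.\<close>

definition balanced :: "('a::finite \<Rightarrow> real) \<Rightarrow> 'a \<Rightarrow> real \<Rightarrow> bool" where
  "balanced p c t \<longleftrightarrow> is_law p \<and> peak p c t \<and> (\<forall>x. psi CARD('a) t \<le> p x)"

lemma ex_neq:
  assumes "CARD('a::finite) \<ge> 2"
  shows "\<exists>d::'a. d \<noteq> c"
proof (rule ccontr)
  assume "\<not> ?thesis"
  then have "(UNIV :: 'a set) = {c}" by auto
  then have "CARD('a) = card {c}" by (rule arg_cong)
  then show False using assms by simp
qed

lemma ex_peak:
  fixes p :: "'a::finite \<Rightarrow> real"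
  assumes "CARD('a) \<ge> 2"
  shows "\<exists>c t. peak p c t"
proof -
  obtain c where c: "p c = Max (range p)"
    using Max_in[of "range p"] by fastforce
  have "- {c} \<noteq> {}" using ex_neq[OF assms, of c] by auto
  then obtain d where d: "d \<in> - {c}" "p d = Max (p ` (- {c}))"
    using Max_in[of "p ` (- {c})"] by fastforce
  have "p d \<le> p c" unfolding c by (rule Max_ge) auto
  moreover have "p x \<le> p d" if "x \<noteq> c" for x
    unfolding d(2) using that by (intro Max_ge) auto
  ultimately have "peak p c (p d)" unfolding peak_def using d(1) by blast
  then show ?thesis by blast
qed

text \<open>A value attained or exceeded at two different points is at most the second atom, so the peak of
the law need not be located.\<close>

lemma ex_balancedI:
  fixes p :: "'a::finite \<Rightarrow> real"
  assumes "CARD('a) \<ge> 2" "is_law p"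
    and "\<And>s x y z. 0 \<le> s \<Longrightarrow> y \<noteq> z \<Longrightarrow> s \<le> p y \<Longrightarrow> s \<le> p z \<Longrightarrow> psi CARD('a) s \<le> p x"
  shows "\<exists>c t. balanced p c t"
proof -
  obtain c t where pk: "peak p c t" using ex_peak[OF assms(1)] by blast
  then obtain d where d: "d \<noteq> c" "p d = t" by (auto simp: peak_def)
  have "psi CARD('a) t \<le> p x" for x
  proof (rule assms(3))
    show "d \<noteq> c" "t \<le> p d" "t \<le> p c" "0 \<le> t"
      using d pk assms(2) by (auto simp: peak_def is_law_def)
  qed
  then show ?thesis using pk assms(2) by (auto simp: balanced_def)
qed

lemma sum_two_ge:
  fixes p :: "'a::finite \<Rightarrow> real"
  assumes "x \<noteq> y" "\<And>z. l \<le> p z"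
  shows "p x + p y + (real CARD('a) - 2) * l \<le> (\<Sum>z\<in>UNIV. p z)"
proof -
  have card: "card {x, y} = 2" using assms by simp
  then have "2 \<le> CARD('a)" using card_mono[of UNIV "{x, y}"] by simp
  have "(\<Sum>z\<in>UNIV. p z) = (\<Sum>z\<in>{x, y}. p z) + (\<Sum>z\<in>UNIV - {x, y}. p z)"
    by (subst sum.subset_diff[of "{x, y}" UNIV]) auto
  moreover have "(\<Sum>z\<in>UNIV - {x, y}. l) \<le> (\<Sum>z\<in>UNIV - {x, y}. p z)"
    using assms by (intro sum_mono) auto
  moreover have "(\<Sum>z\<in>UNIV - {x, y}. l) = (real CARD('a) - 2) * l"
  proof -
    have "real (CARD('a) - 2) = real CARD('a) - 2" using \<open>2 \<le> CARD('a)\<close> by linarith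
    moreover have "card (UNIV - {x, y}) = CARD('a) - 2" using card by (subst card_Diff_subset) auto
    ultimately show ?thesis by simp
  qed
  moreover have "(\<Sum>z\<in>{x, y}. p z) = p x + p y" using assms by simp
  ultimately show ?thesis by linarith
qed

lemma balanced_admissible:
  fixes p :: "'a::finite \<Rightarrow> real"
  assumes "CARD('a) \<ge> 2" "balanced p c t"
  shows "admissible CARD('a) t"
proof -
  obtain d where d: "d \<noteq> c" "p d = t" using assms by (auto simp: balanced_def peak_def)
  have law: "is_law p" and tc: "t \<le> p c" and l: "\<And>x. psi CARD('a) t \<le> p x"
    using assms by (auto simp: balanced_def peak_def)
  have "p c + p d + (real CARD('a) - 2) * psi CARD('a) t \<le> 1"
    using sum_two_ge[of c d "psi CARD('a) t" p] l d law by (simp add: is_law_def)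
  moreover have "t \<le> 1"
    using sum_two_ge[of c d 0 p] d law by (simp add: is_law_def) (smt (verit))
  moreover have "0 \<le> t" using d law by (auto simp: is_law_def)
  ultimately show ?thesis using tc d by (simp add: admissible_def bulk_def)
qed

section \<open>Combining two independent laws\<close>

text \<open>Splitting the weights as \<open>q = n + (q - n)\<close> with \<open>q - n \<ge> 0\<close> gives the next three bounds.\<close>

lemma weighted_sum_ge:
  fixes q h :: "'a \<Rightarrow> real"
  assumes "\<And>y. y \<in> A \<Longrightarrow> n \<le> q y" "\<And>y. y \<in> A \<Longrightarrow> m \<le> h y"
  shows "n * sum h A + (sum q A - real (card A) * n) * m \<le> (\<Sum>y\<in>A. q y * h y)"
proof -
  have "(\<Sum>y\<in>A. (q y - n) * m) \<le> (\<Sum>y\<in>A. (q y - n) * h y)"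
    using assms by (intro sum_mono mult_left_mono) auto
  then show ?thesis
    by (simp add: sum_distrib_left left_diff_distrib sum_subtractf sum_distrib_right)
qed

lemma weighted_sum_le:
  fixes q h :: "'a \<Rightarrow> real"
  assumes "\<And>y. y \<in> A \<Longrightarrow> n \<le> q y" "\<And>y. y \<in> A \<Longrightarrow> h y \<le> t"
  shows "(\<Sum>y\<in>A. q y * h y) \<le> n * sum h A + (sum q A - real (card A) * n) * t"
proof -
  have "(\<Sum>y\<in>A. (q y - n) * h y) \<le> (\<Sum>y\<in>A. (q y - n) * t)"
    using assms by (intro sum_mono mult_left_mono) auto
  then show ?thesis
    by (simp add: sum_distrib_left left_diff_distrib sum_subtractf sum_distrib_right)
qed

lemma weighted_sum_le_except:
  fixes q h :: "'a \<Rightarrow> real"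
  assumes "finite A" "y0 \<in> A" "\<And>y. y \<in> A \<Longrightarrow> n \<le> q y" "\<And>y. y \<in> A \<Longrightarrow> y \<noteq> y0 \<Longrightarrow> h y \<le> t"
  shows "(\<Sum>y\<in>A. q y * h y)
    \<le> n * sum h A + (sum q A - real (card A) * n) * t + (q y0 - n) * (h y0 - t)"
proof -
  have "(\<Sum>y\<in>A. (q y - n) * (h y - t)) = (q y0 - n) * (h y0 - t) + (\<Sum>y\<in>A - {y0}. (q y - n) * (h y - t))"
    using assms by (simp add: sum.remove)
  also have "(\<Sum>y\<in>A - {y0}. (q y - n) * (h y - t)) \<le> 0"
    using assms by (intro sum_nonpos mult_nonneg_nonpos) auto
  finally show ?thesis
    by (simp add: sum_distrib_left sum_distrib_right sum.distrib sum_subtractf algebra_simps)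
qed

text \<open>The law of \<open>f Y Z\<close> for independent \<open>Y\<close>, \<open>Z\<close> with laws \<open>p\<close>, \<open>q\<close>.\<close>

definition combine :: "('a \<Rightarrow> 'a \<Rightarrow> 'a) \<Rightarrow> ('a::finite \<Rightarrow> real) \<Rightarrow> ('a \<Rightarrow> real) \<Rightarrow> 'a \<Rightarrow> real" where
  "combine f p q x = (\<Sum>y\<in>UNIV. \<Sum>z\<in>UNIV. p y * q z * of_bool (f y z = x))"

lemma combine_commute:
  assumes "\<And>y z. f y z = f z y"
  shows "combine f p q = combine f q p"
proof
  fix x
  have "combine f p q x = (\<Sum>z\<in>UNIV. \<Sum>y\<in>UNIV. p y * q z * of_bool (f y z = x))"
    unfolding combine_def by (rule sum.swap)
  then show "combine f p q x = combine f q p x"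
    by (simp add: combine_def assms mult_ac)
qed

lemma is_law_combine:
  assumes "is_law p" "is_law q"
  shows "is_law (combine f p q)"
proof -
  have "(\<Sum>x\<in>UNIV. combine f p q x)
      = (\<Sum>y\<in>UNIV. \<Sum>z\<in>UNIV. \<Sum>x\<in>UNIV. p y * q z * of_bool (f y z = x))"
    unfolding combine_def by (subst sum.swap, intro sum.cong sum.swap refl)
  also have "\<dots> = (\<Sum>y\<in>UNIV. \<Sum>z\<in>UNIV. p y * q z)"
    by (simp flip: sum_distrib_left)
  also have "\<dots> = 1" using assms by (simp add: is_law_def flip: sum_distrib_left)
  finally show ?thesis using assms by (auto simp: is_law_def combine_def intro!: sum_nonneg)
qed

lemma combine_plus:
  fixes p q :: "'a::{finite, ab_group_add} \<Rightarrow> real"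
  shows "combine (+) q p x = (\<Sum>y\<in>UNIV. q y * p (x - y))"
proof -
  have "(y + z = x) = (z = x - y)" for y z by (auto simp: algebra_simps)
  then show ?thesis unfolding combine_def by simp
qed

lemma combine_times:
  fixes p q :: "'a::{finite, field} \<Rightarrow> real"
  assumes "x \<noteq> 0"
  shows "combine (*) q p x = (\<Sum>y\<in>-{0}. q y * p (x / y))"
proof -
  have "(\<Sum>z\<in>UNIV. q y * p z * of_bool (y * z = x)) = (if y = 0 then 0 else q y * p (x / y))" for y
  proof (cases "y = 0")
    case False
    then have "(y * z = x) = (z = x / y)" for z by (auto simp: field_simps)
    then show ?thesis using False by simp
  qed (use assms in auto)
  then show ?thesis unfolding combine_def by (simp add: sum.If_cases)
qed

lemma combine_times_0:
  fixes p q :: "'a::{finite, field} \<Rightarrow> real"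
  assumes "is_law p" "is_law q"
  shows "combine (*) q p 0 = 1 - (1 - q 0) * (1 - p 0)"
proof -
  have "(\<Sum>z\<in>UNIV. q y * p z * of_bool (y * z = 0)) = (if y = 0 then q 0 else q y * p 0)" for y
    using assms by (simp add: is_law_def flip: sum_distrib_left)
  then have "combine (*) q p 0 = q 0 + (\<Sum>y\<in>-{0}. q y) * p 0"
    unfolding combine_def by (simp add: sum.If_cases sum_distrib_right)
  also have "(\<Sum>y\<in>-{0}. q y) = 1 - q 0"
    using assms(2) sum.remove[of UNIV 0 q] by (simp add: is_law_def Compl_eq_Diff_UNIV)
  finally show ?thesis by (simp add: algebra_simps)
qed

lemma sum_nonzero_law:
  fixes p :: "'a::{finite, zero} \<Rightarrow> real"
  assumes "is_law p"
  shows "(\<Sum>y\<in>-{0}. p y) = 1 - p 0"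
  using assms sum.remove[of UNIV 0 p] by (simp add: is_law_def Compl_eq_Diff_UNIV)

section \<open>Closure under addition\<close>

lemma ex_balanced_plus_ordered:
  fixes p q :: "'a::{finite, ab_group_add} \<Rightarrow> real"
  assumes k: "CARD('a) \<ge> 2" and p: "balanced p c t" and q: "balanced q c' t'" and "t \<le> t'"
  shows "\<exists>c t. balanced (combine (+) q p) c t"
proof (rule ex_balancedI[OF k])
  define k' where "k' = CARD('a)"
  define n m b where "n = psi k' t'" and "m = psi k' t" and "b = 1 - real k' * n"
  have laws: "is_law p" "is_law q" using p q by (auto simp: balanced_def)
  show "is_law (combine (+) q p)" using laws by (rule is_law_combine[rotated])
  fix s x z1 z2
  assume s: "0 \<le> s" "z1 \<noteq> z2" "s \<le> combine (+) q p z1" "s \<le> combine (+) q p z2"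
  have shift: "(\<Sum>y\<in>UNIV. p (x - y)) = 1" for x
  proof -
    have "(\<Sum>y\<in>UNIV. p (x - y)) = (\<Sum>y\<in>UNIV. p y)"
      by (rule sum.reindex_bij_witness[of _ "\<lambda>y. x - y" "\<lambda>y. x - y"]) auto
    then show ?thesis using laws by (simp add: is_law_def)
  qed
  have pq: "\<And>x. m \<le> p x" "\<And>x. n \<le> q x" "\<And>x. x \<noteq> c \<Longrightarrow> p x \<le> t" "\<And>x. x \<noteq> c' \<Longrightarrow> q x \<le> t'"
    using p q by (auto simp: balanced_def peak_def m_def n_def k'_def)
  have adm: "admissible k' t" "admissible k' t'"
    using balanced_admissible[OF k] p q by (auto simp: k'_def)
  have k2: "k' \<ge> 2" using k by (simp add: k'_def)
  have t: "0 \<le> t" "0 \<le> t'" "t' \<le> 1" using adm by (auto simp: admissible_def)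
  have m: "0 \<le> m" using psi_nonneg[OF k2, of t] t assms(4) by (simp add: m_def)
  have lower: "n + b * m \<le> combine (+) q p x" for x
    using weighted_sum_ge[of UNIV n q m "\<lambda>y. p (x - y)"] pq laws
    by (simp add: combine_plus shift b_def k'_def is_law_def)
  have b: "0 \<le> b"
    using sum_mono[of UNIV "\<lambda>_. n" q] pq laws by (simp add: b_def k'_def is_law_def)
  have upper: "combine (+) q p z \<le> t' + b * t" if z: "z \<noteq> c + c'" for z
  proof -
    have "combine (+) q p z \<le> n + b * t + (q (z - c) - n) * (p c - t)"
      using weighted_sum_le_except[of UNIV "z - c" n q "\<lambda>y. p (z - y)" t] pq laws
      by (auto simp: combine_plus shift b_def k'_def is_law_def algebra_simps)
    also have "(q (z - c) - n) * (p c - t) \<le> (q (z - c) - n) * 1"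
    proof (rule mult_left_mono)
      have "p c \<le> 1" using laws member_le_sum[of c UNIV p] by (simp add: is_law_def)
      then show "p c - t \<le> 1" using t by simp
    qed (use pq in auto)
    also have "q (z - c) \<le> t'" using z by (intro pq) (auto simp: algebra_simps)
    finally show ?thesis by simp
  qed
  \<comment> \<open>At least one of the two points differs from the sum of the peaks.\<close>
  have "s \<le> t' + b * t" using s upper[of z1] upper[of z2] by fastforce
  have "psi k' s \<le> n + b * m"
  proof (cases "s \<le> t'")
    case True
    then have "psi k' s \<le> n" unfolding n_def by (rule psi_mono_admissible[OF k2 adm(2)])
    then show ?thesis using b m by (smt (verit) mult_nonneg_nonneg)
  next
    case False
    have t0: "0 < t"
    proof (rule ccontr)
      assume "\<not> 0 < t"
      then show False using \<open>s \<le> t' + b * t\<close> False t by simp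
    qed
    obtain y z where "y \<noteq> z" "s \<le> combine (+) q p y" using s by blast
    have "s \<le> 1"
      using \<open>s \<le> combine (+) q p y\<close> is_law_combine[OF laws(2,1), of "(+)"] 
        member_le_sum[of y UNIV "combine (+) q p"] by (simp add: is_law_def)
    then have "psi k' (t' + (s - t')) - psi k' t' \<le> (s - t') * (psi k' t / t)"
      using False t0 assms(4) by (intro psi_increment_le[OF k2]) auto
    also have "\<dots> \<le> (b * t) * (psi k' t / t)"
      using \<open>s \<le> t' + b * t\<close> m t by (intro mult_right_mono) (auto simp: m_def)
    finally show ?thesis using t0 by (simp add: n_def m_def)
  qed
  then show "psi CARD('a) s \<le> combine (+) q p x" using lower[of x] by (simp add: k'_def)
qed

lemma ex_balanced_plus:
  fixes p q :: "'a::{finite, ab_group_add} \<Rightarrow> real"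
  assumes "CARD('a) \<ge> 2" "balanced p c t" "balanced q c' t'"
  shows "\<exists>c t. balanced (combine (+) q p) c t"
proof (cases "t \<le> t'")
  case False
  then have "\<exists>c t. balanced (combine (+) p q) c t"
    using assms by (intro ex_balanced_plus_ordered) auto
  then show ?thesis by (simp add: combine_commute[of "(+)" q p] add.commute)
qed (rule ex_balanced_plus_ordered[OF assms])

section \<open>Closure under multiplication\<close>

lemma card_nonzero: "real (card (- {0 :: 'a::{finite, zero}})) = real CARD('a) - 1"
proof -
  have "CARD('a) \<noteq> 0" by simp
  then show ?thesis by (simp add: Compl_eq_Diff_UNIV of_nat_diff)
qed

text \<open>The mass \<open>b\<close> of \<open>q\<close> above its floor on the units. If the peak is nonzero, then the atom at zero is
at most \<open>t\<close> and the floor is also at least \<open>psi k (q 0)\<close>. If the peak is at zero, the atom at zero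
is at least \<open>t\<close> and the other atoms are at most \<open>t\<close>.\<close>

lemma nonzero_law_bounds:
  fixes q :: "'a::{finite, field} \<Rightarrow> real"
  assumes k: "CARD('a) \<ge> 2" and q: "balanced q c t"
  defines "k' \<equiv> CARD('a)"
  defines "n \<equiv> psi k' t" and "b \<equiv> 1 - q 0 - (real CARD('a) - 1) * psi CARD('a) t"
  shows "0 \<le> n" "0 \<le> b" "c \<noteq> 0 \<Longrightarrow> b \<le> (1 - q 0) ^ k'"
    "c = 0 \<Longrightarrow> b \<le> (1 - t) ^ k'" "c = 0 \<Longrightarrow> b \<le> (real k' - 1) * excess k' t"
    "c = 0 \<Longrightarrow> bulk k' t \<le> 1 - q 0" "0 \<le> q 0" "q 0 \<le> 1"
proof -
  have law: "is_law q" and tc: "t \<le> q c" and l: "\<And>x. n \<le> q x" and u: "\<And>x. x \<noteq> c \<Longrightarrow> q x \<le> t"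
    using q by (auto simp: balanced_def peak_def n_def k'_def)
  have k2: "k' \<ge> 2" using k by (simp add: k'_def)
  have adm: "admissible k' t" using balanced_admissible[OF k q] by (simp add: k'_def)
  then have t: "0 \<le> t" "t \<le> 1" by (auto simp: admissible_def)
  show "0 \<le> n" unfolding n_def by (rule psi_nonneg[OF k2 t])
  have card: "real (card (- {0 :: 'a})) = real k' - 1"
    unfolding k'_def by (rule card_nonzero)
  have b: "b = 1 - q 0 - (real k' - 1) * n" by (simp add: b_def n_def k'_def)
  have "(\<Sum>y\<in>-{0::'a}. n) \<le> (\<Sum>y\<in>-{0}. q y)" using l by (intro sum_mono)
  then show b0: "0 \<le> b" unfolding b sum_nonzero_law[OF law] by (simp add: card)
  show q0: "0 \<le> q 0" using law by (simp add: is_law_def)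
  show q1: "q 0 \<le> 1" using sum_nonzero_law[OF law] law sum_nonneg[of "-{0}" q]
    by (simp add: is_law_def)
  {
    assume "c \<noteq> 0"
    then have "psi k' (q 0) \<le> n" unfolding n_def using u by (intro psi_mono_admissible[OF k2 adm]) auto
    then have "(real k' - 1) * psi k' (q 0) \<le> (real k' - 1) * n"
      using k2 by (intro mult_left_mono) auto
    then show "b \<le> (1 - q 0) ^ k'" unfolding psi_mult[OF k2] b by simp
  }
  {
    assume c: "c = 0"
    then show "b \<le> (1 - t) ^ k'"
      using psi_mult[OF k2, of t] tc by (simp add: b n_def)
    have "(\<Sum>y\<in>-{0::'a}. q y) \<le> (\<Sum>y\<in>-{0::'a}. t)" using u c by (intro sum_mono) auto
    then have "1 - q 0 \<le> (real k' - 1) * t" unfolding sum_nonzero_law[OF law] by (simp add: card)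
    then show "b \<le> (real k' - 1) * excess k' t"
      by (simp add: b n_def excess_def algebra_simps)
    obtain d where d: "d \<noteq> c" "q d = t" using q by (auto simp: balanced_def peak_def)
    have "q 0 + q d + (real CARD('a) - 2) * n \<le> 1"
      using sum_two_ge[of 0 d n q] l d law c by (auto simp: is_law_def)
    then show "bulk k' t \<le> 1 - q 0" using d by (simp add: bulk_def n_def k'_def)
  }
qed

lemma combine_times_bounds:
  fixes p q :: "'a::{finite, field} \<Rightarrow> real"
  assumes k: "CARD('a) \<ge> 2" and laws: "is_law p" "is_law q" and n: "\<And>y. n \<le> q y" and x: "x \<noteq> 0"
  defines "b \<equiv> 1 - q 0 - (real CARD('a) - 1) * n"
  shows "(\<And>y. m \<le> p y) \<Longrightarrow> n * (1 - p 0) + b * m \<le> combine (*) q p x"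
    and "(\<And>y. y \<noteq> 0 \<Longrightarrow> p y \<le> t) \<Longrightarrow> combine (*) q p x \<le> n * (1 - p 0) + b * t"
    and "c \<noteq> 0 \<Longrightarrow> (\<And>y. y \<noteq> c \<Longrightarrow> p y \<le> t) \<Longrightarrow>
      combine (*) q p x \<le> n * (1 - p 0) + b * t + (q (x / c) - n) * (p c - t)"
proof -
  have "(\<Sum>y\<in>-{0}. p (x / y)) = (\<Sum>y\<in>-{0}. p y)"
    by (rule sum.reindex_bij_witness[of _ "\<lambda>y. x / y" "\<lambda>y. x / y"]) (use x in auto)
  then have sp: "(\<Sum>y\<in>-{0}. p (x / y)) = 1 - p 0" by (simp add: sum_nonzero_law[OF laws(1)])
  note card = card_nonzero[where 'a = 'a]
  have b: "sum q (- {0}) - real (card (- {0 :: 'a})) * n = b"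
    by (simp add: card b_def sum_nonzero_law[OF laws(2)])
  show "n * (1 - p 0) + b * m \<le> combine (*) q p x" if "\<And>y. m \<le> p y"
    using weighted_sum_ge[of "-{0}" n q m "\<lambda>y. p (x / y)"] n that
    unfolding sp b combine_times[OF x] by blast
  show "combine (*) q p x \<le> n * (1 - p 0) + b * t" if "\<And>y. y \<noteq> 0 \<Longrightarrow> p y \<le> t"
    using weighted_sum_le[of "-{0}" n q "\<lambda>y. p (x / y)" t] n that x
    unfolding sp b combine_times[OF x] by simp
  show "combine (*) q p x \<le> n * (1 - p 0) + b * t + (q (x / c) - n) * (p c - t)"
    if "c \<noteq> 0" "\<And>y. y \<noteq> c \<Longrightarrow> p y \<le> t"
  proof -
    have "p (x / y) \<le> t" if "y \<noteq> x / c" "y \<in> -{0}" for y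
      using that \<open>c \<noteq> 0\<close> by (intro \<open>\<And>y. y \<noteq> c \<Longrightarrow> p y \<le> t\<close>) (auto simp: field_simps)
    then show ?thesis
      using weighted_sum_le_except[of "-{0}" "x / c" n q "\<lambda>y. p (x / y)" t] n that x
      unfolding sp b combine_times[OF x] by simp
  qed
qed

text \<open>All nonzero atoms of the product lie between \<open>n * (1 - p 0) + b * m\<close> and
\<open>R = n * (1 - p 0) + b * t\<close>, and one of any two different points is nonzero. So the second atom
is at most \<open>R\<close>, and \<open>R \<le> t\<close> keeps it on the increasing branch of \<open>psi k\<close>.\<close>

lemma ex_balanced_times_peak_zero:
  fixes p q :: "'a::{finite, field} \<Rightarrow> real"
  assumes k4: "CARD('a) \<ge> 4" and p: "balanced p 0 t" and q: "balanced q c t'"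
    and ord: "c = 0 \<Longrightarrow> t \<le> t'"
  shows "\<exists>c t. balanced (combine (*) q p) c t"
proof (rule ex_balancedI)
  define k where "k = CARD('a)"
  define n m b R where "n = psi k t'" and "m = psi k t" and "b = 1 - q 0 - (real k - 1) * n"
    and "R = n * (1 - p 0) + b * t"
  have laws: "is_law p" "is_law q" using p q by (auto simp: balanced_def)
  show k2': "CARD('a) \<ge> 2" using k4 by simp
  then have k2: "k \<ge> 2" by (simp add: k_def)
  show "is_law (combine (*) q p)" using laws by (rule is_law_combine[rotated])
  fix s x z1 z2
  assume s: "0 \<le> s" "z1 \<noteq> z2" "s \<le> combine (*) q p z1" "s \<le> combine (*) q p z2"
  have pq: "\<And>x. m \<le> p x" "\<And>x. n \<le> q x" "\<And>x. x \<noteq> 0 \<Longrightarrow> p x \<le> t" "t \<le> p 0"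
    using p q by (auto simp: balanced_def peak_def m_def n_def k_def)
  note pb = nonzero_law_bounds[OF k2' p] and qb = nonzero_law_bounds[OF k2' q]
  have adm: "admissible k t" "admissible k t'"
    using balanced_admissible[OF k2'] p q by (auto simp: k_def)
  have t: "0 \<le> t" "t \<le> 1" using adm by (auto simp: admissible_def)
  have b0: "0 \<le> b" and n0: "0 \<le> n" using qb by (auto simp: b_def n_def k_def)
  have Qe: "(real k - 1) * n + b = 1 - q 0" by (simp add: b_def)
  have bulk: "bulk k t \<le> 1 - p 0" using pb by (simp add: k_def)
  have Rt: "R \<le> t"
  proof -
    have "(\<Sum>y\<in>-{0::'a}. p y) \<le> (\<Sum>y\<in>-{0::'a}. t)" using pq by (intro sum_mono) auto
    also have "\<dots> = (real k - 1) * t" by (simp add: card_nonzero k_def)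
    finally have "n * (1 - p 0) \<le> n * ((real k - 1) * t)"
      unfolding sum_nonzero_law[OF laws(1)] using n0 by (intro mult_left_mono)
    then have "R \<le> ((real k - 1) * n + b) * t" by (simp add: R_def algebra_simps)
    also have "\<dots> \<le> 1 * t" unfolding Qe using t qb by (intro mult_right_mono) auto
    finally show ?thesis by simp
  qed
  have main: "psi k R \<le> n * (1 - p 0) + b * m"
  proof (cases "c = 0")
    case True
    then show ?thesis unfolding R_def n_def m_def using k4 adm ord bulk b0 qb Rt
      by (intro psi_le_mixture_of_dispersed) (auto simp: k_def b_def n_def R_def)
  next
    case False
    then have "b \<le> ((real k - 1) * n + b) ^ k"
      unfolding Qe using qb(3) by (simp add: b_def n_def k_def)
    then show ?thesis
      unfolding R_def m_def using Rt by (intro psi_le_mixture k2 adm bulk b0 n0) (simp_all add: R_def)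
  qed
  have "s \<le> R"
  proof -
    have "combine (*) q p z \<le> R" if "z \<noteq> 0" for z
      using combine_times_bounds(2)[OF k2' laws pq(2) that, of t] pq by (simp add: R_def b_def k_def)
    from this[of z1] this[of z2] show ?thesis using s by (cases "z1 = 0") auto
  qed
  show "psi CARD('a) s \<le> combine (*) q p x"
  proof (cases "x = 0")
    case True
    have "psi k s \<le> s" using \<open>s \<le> R\<close> Rt t by (intro psi_le_self[OF k2]) auto
    also have "\<dots> \<le> p 0" using \<open>s \<le> R\<close> Rt pq by simp
    also have "\<dots> \<le> p 0 + q 0 * (1 - p 0)" using pb qb by simp
    also have "\<dots> = combine (*) q p 0"
      by (simp add: combine_times_0[OF laws] algebra_simps)
    finally show ?thesis using True by (simp add: k_def)
  next
    case False
    have "psi k s \<le> psi k R"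
      using admissible_antimono[OF k2 adm(1)] \<open>s \<le> R\<close> s(1) Rt by (intro psi_mono_admissible[OF k2]) auto
    also note main
    also have "n * (1 - p 0) + b * m \<le> combine (*) q p x"
      using combine_times_bounds(1)[OF k2' laws pq(2) False, of m] pq by (simp add: b_def k_def)
    finally show ?thesis by (simp add: k_def)
  qed
qed

text \<open>The second atom \<open>s\<close> is at most \<open>1 - (1 - t) * (1 - t')\<close>. If it is at least the atom at zero,
\<open>psi_le_product_floor\<close> applies directly. Otherwise the atom at zero exceeds it; the lemma then
bounds \<open>psi k\<close> at the atom at zero, and \<open>psi_le_reflect\<close> transfers the bound to \<open>s\<close>.\<close>

lemma ex_balanced_times_peaks_nonzero:
  fixes p q :: "'a::{finite, field} \<Rightarrow> real"
  assumes k3: "CARD('a) \<ge> 3" and p: "balanced p c t" "c \<noteq> 0" and q: "balanced q c' t'" "c' \<noteq> 0"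
  shows "\<exists>c t. balanced (combine (*) q p) c t"
proof (rule ex_balancedI)
  define k where "k = CARD('a)"
  define n m b L where "n = psi k t'" and "m = psi k t" and "b = 1 - q 0 - (real k - 1) * n"
    and "L = m * (1 - q 0) + n * (1 - p 0) - (real k - 1) * m * n"
  define r where "r = combine (*) q p"
  have laws: "is_law p" "is_law q" using p q by (auto simp: balanced_def)
  show k2': "CARD('a) \<ge> 2" using k3 by simp
  then have k2: "k \<ge> 2" by (simp add: k_def)
  show lawr: "is_law (combine (*) q p)" using laws by (rule is_law_combine[rotated])
  fix s x z1 z2
  assume "0 \<le> s" "z1 \<noteq> z2" "s \<le> combine (*) q p z1" "s \<le> combine (*) q p z2"
  then have s: "0 \<le> s" "z1 \<noteq> z2" "s \<le> r z1" "s \<le> r z2" by (auto simp: r_def)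
  have pq: "\<And>x. m \<le> p x" "\<And>x. n \<le> q x" "\<And>x. x \<noteq> c \<Longrightarrow> p x \<le> t" "\<And>x. x \<noteq> c' \<Longrightarrow> q x \<le> t'"
    "t \<le> p c"
    using p q by (auto simp: balanced_def peak_def m_def n_def k_def)
  note pb = nonzero_law_bounds[OF k2' p(1)] and qb = nonzero_law_bounds[OF k2' q(1)]
  have adm: "admissible k t" "admissible k t'"
    using balanced_admissible[OF k2'] p q by (auto simp: k_def)
  have t: "0 \<le> t" "t \<le> 1" "0 \<le> t'" "t' \<le> 1" using adm by (auto simp: admissible_def)
  have pos: "0 \<le> b" "0 \<le> n" "0 \<le> m" "0 \<le> p 0" "p 0 \<le> 1" "0 \<le> q 0" "q 0 \<le> 1"
    using qb pb by (auto simp: b_def n_def m_def k_def)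
  have p0: "p 0 \<le> t" and q0: "q 0 \<le> t'" using pq p(2) q(2) by auto
  have r0: "r 0 = 1 - (1 - p 0) * (1 - q 0)" unfolding r_def by (simp add: combine_times_0[OF laws])
  have lower: "L \<le> r x" if "x \<noteq> 0" for x
    using combine_times_bounds(1)[OF k2' laws pq(2) that, of m] pq
    by (simp add: L_def b_def k_def r_def algebra_simps)
  have r0_le: "r 0 \<le> 1 - (1 - t) * (1 - t')"
    unfolding r0 using p0 q0 t by (intro diff_left_mono mult_mono) auto
  have L_ge: "psi k v \<le> L" if "r 0 \<le> v" "v \<le> 1 - (1 - t) * (1 - t')" for v
    unfolding L_def m_def n_def using adm p0 q0 pos that
    by (intro psi_le_product_floor[OF k2]) (auto simp: r0)
  have L_le_r0: "L \<le> r 0"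
  proof -
    have "L = m + n - m * q 0 - n * p 0 - (real k - 1) * m * n" by (simp add: L_def algebra_simps)
    also have "\<dots> \<le> m + n - m * n"
    proof -
      have "m * n \<le> m * q 0" using pos pq by (intro mult_left_mono) auto
      moreover have "0 \<le> (real k - 1) * m * n" "0 \<le> n * p 0" using pos k2 by auto
      ultimately show ?thesis by linarith
    qed
    also have "\<dots> = 1 - (1 - m) * (1 - n)" by (simp add: algebra_simps)
    also have "\<dots> \<le> r 0" unfolding r0 using pos pq(1)[of 0] pq(2)[of 0]
      by (intro diff_left_mono mult_mono) linarith+
    finally show ?thesis .
  qed
  have upper: "r z \<le> 1 - (1 - t) * (1 - t')" if z: "z \<noteq> 0" "z \<noteq> c * c'" for z
  proof -
    have "r z \<le> n * (1 - p 0) + b * t + (q (z / c) - n) * (p c - t)"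
      unfolding r_def b_def k_def
      by (rule combine_times_bounds(3)[OF k2' laws pq(2) z(1) p(2) pq(3)])
    also have "n * (1 - p 0) \<le> n * 1" using pos by (intro mult_left_mono) auto
    also have "(q (z / c) - n) * (p c - t) \<le> (q (z / c) - n) * 1"
    proof (rule mult_left_mono)
      have "p c \<le> 1" using laws member_le_sum[of c UNIV p] by (simp add: is_law_def)
      then show "p c - t \<le> 1" using t by simp
    qed (use pq in auto)
    also have "q (z / c) \<le> t'" using z p(2) by (intro pq) (auto simp: field_simps)
    also have "b * t \<le> (1 - t') * t"
    proof (rule mult_right_mono)
      have "b \<le> 1 - real k * n" using pq(2)[of 0] by (simp add: b_def algebra_simps)
      then show "b \<le> 1 - t'" using admissible_le_psi[OF k2 adm(2)] by (simp add: n_def)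
    qed (use t in auto)
    finally show ?thesis by (simp add: algebra_simps)
  qed
  have s_le: "s \<le> 1 - (1 - t) * (1 - t')"
  proof -
    consider "z1 = 0 \<or> z2 = 0" | "z1 \<noteq> 0 \<and> z1 \<noteq> c * c'" | "z2 \<noteq> 0 \<and> z2 \<noteq> c * c'"
      using s(2) by blast
    then show ?thesis
    proof cases
      case 1
      then have "s \<le> r 0" using s by auto
      then show ?thesis using r0_le by simp
    next
      case 2
      then show ?thesis using upper[of z1] s by simp
    next
      case 3
      then show ?thesis using upper[of z2] s by simp
    qed
  qed
  have "psi k s \<le> L"
  proof (cases "r 0 \<le> s")
    case True
    then show ?thesis using s_le by (rule L_ge)
  next
    case False
    obtain z where z: "z \<noteq> 0" "s \<le> r z" using s by (cases "z1 = 0") auto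
    have "L \<le> r y" for y using lower[of y] L_le_r0 by (cases "y = 0") auto
    then have "r 0 + r z + (real k - 2) * L \<le> (\<Sum>y\<in>UNIV. r y)"
      unfolding k_def using z(1) by (intro sum_two_ge) auto
    then have "r 0 + r z + (real k - 2) * L \<le> 1"
      using lawr by (simp add: is_law_def r_def)
    then have "r 0 + s + (real k - 2) * L \<le> 1" using z(2) by linarith
    moreover have "r 0 \<le> 1" unfolding r0 using pos by simp
    ultimately show ?thesis
      using psi_le_reflect[of k "r 0" L s] k3 s(1) False L_ge[OF order_refl r0_le]
      by (simp add: k_def)
  qed
  moreover have "L \<le> r x" using lower[of x] L_le_r0 by (cases "x = 0") auto
  ultimately show "psi CARD('a) s \<le> combine (*) q p x" by (simp add: k_def r_def)
qed

lemma ex_balanced_times: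
  fixes p q :: "'a::{finite, field} \<Rightarrow> real"
  assumes k4: "CARD('a) \<ge> 4" and p: "balanced p c t" and q: "balanced q c' t'"
  shows "\<exists>c t. balanced (combine (*) q p) c t"
proof -
  have comm: "combine (*) q p = combine (*) p q" by (rule combine_commute) (rule mult.commute)
  consider "c \<noteq> 0" "c' \<noteq> 0" | "c = 0" "c' = 0 \<longrightarrow> t \<le> t'" | "c' = 0" "c = 0 \<longrightarrow> t' \<le> t"
    by linarith
  then show ?thesis
  proof cases
    case 1
    then show ?thesis using k4 ex_balanced_times_peaks_nonzero[OF _ p _ q] by simp
  next
    case 2
    then show ?thesis using k4 p q by (intro ex_balanced_times_peak_zero) auto
  next
    case 3
    then show ?thesis unfolding comm using k4 p q by (intro ex_balanced_times_peak_zero) auto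
  qed
qed

section \<open>Value distributions of read-once formulas\<close>

lemma ex_balanced_point_mass:
  assumes "CARD('a::finite) \<ge> 2"
  shows "\<exists>c t. balanced (\<lambda>x::'a. of_bool (a = x)) c t"
proof (intro exI)
  obtain d where "d \<noteq> a" using ex_neq[OF assms] by blast
  then show "balanced (\<lambda>x::'a. of_bool (a = x)) a 0"
    by (auto simp: balanced_def is_law_def peak_def)
qed

lemma ex_balanced_uniform:
  assumes "CARD('a::finite) \<ge> 2"
  shows "\<exists>c t. balanced (\<lambda>x::'a. 1 / real CARD('a)) c t"
proof (intro exI)
  obtain d :: 'a where "d \<noteq> undefined" using ex_neq[OF assms] by blast
  moreover have "psi CARD('a) (1 / real CARD('a)) \<le> 1 / real CARD('a)"
    using assms by (intro psi_le_self) auto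
  ultimately show "balanced (\<lambda>x::'a. 1 / real CARD('a)) undefined (1 / real CARD('a))"
    by (auto simp: balanced_def is_law_def peak_def)
qed

lemma (in prob_space) prob_binop_eq_combine:
  fixes Y Z :: "'a \<Rightarrow> 'b::finite"
  assumes "indep_var (count_space UNIV) Y (count_space UNIV) Z"
  shows "prob {\<omega> \<in> space M. f (Y \<omega>) (Z \<omega>) = x}
    = combine f (\<lambda>y. prob {\<omega> \<in> space M. Y \<omega> = y}) (\<lambda>z. prob {\<omega> \<in> space M. Z \<omega> = z}) x"
proof -
  have [measurable]: "Y \<in> measurable M (count_space UNIV)" "Z \<in> measurable M (count_space UNIV)"
    using assms by (auto dest: indep_var_rv1 indep_var_rv2)
  define E where "E = (\<lambda>(y, z). {\<omega> \<in> space M. Y \<omega> = y \<and> Z \<omega> = z})"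
  have prod: "prob (E (y, z)) = prob {\<omega> \<in> space M. Y \<omega> = y} * prob {\<omega> \<in> space M. Z \<omega> = z}" for y z
  proof -
    have "prob ((\<lambda>\<omega>. (Y \<omega>, Z \<omega>)) -` ({y} \<times> {z}) \<inter> space M)
        = prob (Y -` {y} \<inter> space M) * prob (Z -` {z} \<inter> space M)"
      by (rule indep_varD[OF assms]) auto
    moreover have "(\<lambda>\<omega>. (Y \<omega>, Z \<omega>)) -` ({y} \<times> {z}) \<inter> space M = E (y, z)"
      "Y -` {y} \<inter> space M = {\<omega> \<in> space M. Y \<omega> = y}" "Z -` {z} \<inter> space M = {\<omega> \<in> space M. Z \<omega> = z}"
      by (auto simp: E_def)
    ultimately show ?thesis by simp
  qed
  have "{\<omega> \<in> space M. f (Y \<omega>) (Z \<omega>) = x} = (\<Union>v\<in>{v. f (fst v) (snd v) = x}. E v)"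
    by (auto simp: E_def)
  also have "prob \<dots> = (\<Sum>v\<in>{v. f (fst v) (snd v) = x}. prob (E v))"
    by (rule finite_measure_finite_Union)
       (auto simp: E_def disjoint_family_on_def split: prod.splits)
  also have "\<dots> = (\<Sum>v\<in>UNIV \<times> UNIV. prob (E v) * of_bool (f (fst v) (snd v) = x))"
    by (rule sum.mono_neutral_cong_left) auto
  also have "\<dots> = combine f (\<lambda>y. prob {\<omega> \<in> space M. Y \<omega> = y}) (\<lambda>z. prob {\<omega> \<in> space M. Z \<omega> = z}) x"
    by (simp add: combine_def prod sum.cartesian_product' flip: UNIV_Times_UNIV)
  finally show ?thesis .
qed

lemma measurable_eval_formula:
  fixes F :: "'a::{finite, field} formula"
  assumes "set (var_leaves F) \<subseteq> A"
  shows "eval_formula F \<in> measurable (PiM A (\<lambda>_. count_space UNIV)) (count_space UNIV)"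
  using assms
proof (induction F)
  case (Var i)
  then have "i \<in> A" by simp
  then have "(\<lambda>x. x i) \<in> measurable (PiM A (\<lambda>_. count_space UNIV)) (count_space (UNIV :: 'a set))"
    by measurable
  then show ?case by (simp add: eval_formula.simps[abs_def])
next
  case (Const c)
  then show ?case by (simp add: eval_formula.simps[abs_def])
next
  case (Add F G)
  then have [measurable]: "eval_formula F \<in> measurable (PiM A (\<lambda>_. count_space UNIV)) (count_space UNIV)"
    "eval_formula G \<in> measurable (PiM A (\<lambda>_. count_space UNIV)) (count_space UNIV)" by auto
  have "(\<lambda>x. eval_formula F x + eval_formula G x) \<in> measurable (PiM A (\<lambda>_. count_space UNIV)) (count_space UNIV)"
    by measurable
  then show ?case by (simp add: eval_formula.simps[abs_def])
next
  case (Mul F G)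
  then have [measurable]: "eval_formula F \<in> measurable (PiM A (\<lambda>_. count_space UNIV)) (count_space UNIV)"
    "eval_formula G \<in> measurable (PiM A (\<lambda>_. count_space UNIV)) (count_space UNIV)" by auto
  have "(\<lambda>x. eval_formula F x * eval_formula G x) \<in> measurable (PiM A (\<lambda>_. count_space UNIV)) (count_space UNIV)"
    by measurable
  then show ?case by (simp add: eval_formula.simps[abs_def])
qed

lemma eval_formula_cong:
  assumes "\<And>i. i \<in> set (var_leaves F) \<Longrightarrow> x i = y i"
  shows "eval_formula F x = eval_formula F y"
  using assms by (induction F) auto

lemma (in prob_space) indep_var_eval_formula:
  fixes X :: "nat \<Rightarrow> 'a \<Rightarrow> 'b::{finite, field}"
  assumes "indep_vars (\<lambda>_. count_space UNIV) X I" "set (var_leaves F) \<subseteq> I" "set (var_leaves G) \<subseteq> I"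
    and "set (var_leaves F) \<inter> set (var_leaves G) = {}"
  shows "indep_var (count_space UNIV) (\<lambda>\<omega>. eval_formula F (\<lambda>i. X i \<omega>))
    (count_space UNIV) (\<lambda>\<omega>. eval_formula G (\<lambda>i. X i \<omega>))"
proof -
  have "indep_var (count_space UNIV) (eval_formula F \<circ> (\<lambda>\<omega>. restrict (\<lambda>i. X i \<omega>) (set (var_leaves F))))
      (count_space UNIV) (eval_formula G \<circ> (\<lambda>\<omega>. restrict (\<lambda>i. X i \<omega>) (set (var_leaves G))))"
    by (rule indep_var_compose[OF indep_var_restrict[OF assms(1,4,2,3)]
          measurable_eval_formula[OF order_refl] measurable_eval_formula[OF order_refl]])
  moreover have "eval_formula H \<circ> (\<lambda>\<omega>. restrict (\<lambda>i. X i \<omega>) (set (var_leaves H)))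
      = (\<lambda>\<omega>. eval_formula H (\<lambda>i. X i \<omega>))" for H
    by (intro ext) (auto intro: eval_formula_cong)
  ultimately show ?thesis by simp
qed

text \<open>Induction on the formula: because no variable is repeated, the two subformulas of a gate depend on
disjoint sets of variables and are independent.\<close>

lemma (in prob_space) ex_balanced_eval_formula:
  fixes X :: "nat \<Rightarrow> 'a \<Rightarrow> 'b::{finite, field}"
  assumes k: "CARD('b) \<ge> 4"
    and indep: "indep_vars (\<lambda>_. count_space UNIV) X I"
    and unif: "\<And>i. i \<in> I \<Longrightarrow> distr M (count_space UNIV) (X i) = uniform_count_measure UNIV"
    and "distinct (var_leaves F)" "set (var_leaves F) \<subseteq> I"
  shows "\<exists>c t. balanced (\<lambda>x. prob {\<omega> \<in> space M. eval_formula F (\<lambda>i. X i \<omega>) = x}) c t"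
  using assms(4,5)
proof (induction F)
  case (Var i)
  have "X i \<in> measurable M (count_space UNIV)" using indep Var by (auto simp: indep_vars_def)
  then have "prob {\<omega> \<in> space M. X i \<omega> = x} = measure (distr M (count_space UNIV) (X i)) {x}" for x
    by (subst measure_distr) (auto intro!: arg_cong[of _ _ prob])
  then have "prob {\<omega> \<in> space M. X i \<omega> = x} = 1 / real CARD('b)" for x
    using unif[of i] Var by (simp add: measure_uniform_count_measure)
  then show ?case using ex_balanced_uniform[where 'a = 'b] k by simp
next
  case (Const c)
  have "prob {\<omega> \<in> space M. eval_formula (Const c) (\<lambda>i. X i \<omega>) = x} = of_bool (c = x)" for x
    by (cases "c = x") (auto simp: prob_space)
  then show ?case using ex_balanced_point_mass[of c] k by simp
next
  case (Add F G)
  then obtain c t c' t' where laws: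
    "balanced (\<lambda>x. prob {\<omega> \<in> space M. eval_formula F (\<lambda>i. X i \<omega>) = x}) c t"
    "balanced (\<lambda>x. prob {\<omega> \<in> space M. eval_formula G (\<lambda>i. X i \<omega>) = x}) c' t'" by auto
  have "indep_var (count_space UNIV) (\<lambda>\<omega>. eval_formula F (\<lambda>i. X i \<omega>))
      (count_space UNIV) (\<lambda>\<omega>. eval_formula G (\<lambda>i. X i \<omega>))"
    using Add by (intro indep_var_eval_formula[OF indep]) auto
  then show ?case
    using ex_balanced_plus[OF _ laws(2,1)] k by (simp add: prob_binop_eq_combine[where f = "(+)"])
next
  case (Mul F G)
  then obtain c t c' t' where laws:
    "balanced (\<lambda>x. prob {\<omega> \<in> space M. eval_formula F (\<lambda>i. X i \<omega>) = x}) c t"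
    "balanced (\<lambda>x. prob {\<omega> \<in> space M. eval_formula G (\<lambda>i. X i \<omega>) = x}) c' t'" by auto
  have "indep_var (count_space UNIV) (\<lambda>\<omega>. eval_formula F (\<lambda>i. X i \<omega>))
      (count_space UNIV) (\<lambda>\<omega>. eval_formula G (\<lambda>i. X i \<omega>))"
    using Mul by (intro indep_var_eval_formula[OF indep]) auto
  then show ?case
    using ex_balanced_times[OF _ laws(2,1)] k by (simp add: prob_binop_eq_combine[where f = "(*)"])
qed

section \<open>The sorted atoms\<close>

lemma sorted_list_of_multiset_two_largest:
  assumes "a \<le> b" "\<And>x. x \<in># N \<Longrightarrow> x \<le> a"
  shows "sorted_list_of_multiset (add_mset b (add_mset a N)) = sorted_list_of_multiset N @ [a, b]"
proof -
  have "sorted (sorted_list_of_multiset N @ [a, b])"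
    using assms by (auto simp: sorted_append intro: order_trans)
  moreover have "mset (sorted_list_of_multiset N @ [a, b]) = add_mset b (add_mset a N)" by simp
  ultimately show ?thesis
    by (metis sorted_list_of_multiset_mset sorted_sort_id)
qed

lemma atom_desc_2_eq:
  assumes "space p = (UNIV :: 'a::finite set)" "peak (\<lambda>x. measure p {x}) c t"
  shows "atom_desc p 2 = t"
proof -
  define g where "g = (\<lambda>x. measure p {x})"
  obtain d where d: "d \<noteq> c" "g d = t" using assms(2) by (auto simp: peak_def g_def)
  have c: "t \<le> g c" "\<And>x. x \<noteq> c \<Longrightarrow> g x \<le> t" using assms(2) by (auto simp: peak_def g_def)
  define N where "N = image_mset g (mset_set (UNIV - {c} - {d}))"
  have "mset_set (UNIV :: 'a set) = add_mset c (mset_set (UNIV - {c}))"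
    by (rule mset_set.remove) auto
  also have "mset_set (UNIV - {c}) = add_mset d (mset_set (UNIV - {c} - {d}))"
    using d by (intro mset_set.remove) auto
  finally have "image_mset g (mset_set UNIV) = add_mset (g c) (add_mset t N)"
    using d by (simp add: N_def)
  moreover have "sorted_list_of_multiset (add_mset (g c) (add_mset t N)) = sorted_list_of_multiset N @ [t, g c]"
    using c by (intro sorted_list_of_multiset_two_largest) (auto simp: N_def)
  ultimately show ?thesis
    unfolding atom_desc_def assms(1) by (simp flip: g_def)
qed

lemma atom_desc_ge:
  assumes "space p = (UNIV :: 'a::finite set)" "\<And>x. l \<le> measure p {x}" "1 \<le> j" "j \<le> CARD('a)"
  shows "l \<le> atom_desc p j"
proof -
  define xs where "xs = rev (sorted_list_of_multiset (image_mset (\<lambda>x. measure p {x}) (mset_set (UNIV :: 'a set))))"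
  have "length xs = size (mset xs)" by simp
  also have "\<dots> = CARD('a)" unfolding xs_def by simp
  finally have "xs ! (j - 1) \<in> set xs" using assms by (intro nth_mem) auto
  then obtain x where "xs ! (j - 1) = measure p {x}" by (auto simp: xs_def)
  then show ?thesis using assms by (simp add: atom_desc_def xs_def)
qed

theorem corollary1p2:
  fixes k N :: nat
    and f :: "(nat \<Rightarrow> 'a::{finite,field}) \<Rightarrow> 'a"
    and M :: "'w measure"
    and X :: "nat \<Rightarrow> 'w \<Rightarrow> 'a"
  assumes "CARD('a) = k" and "k \<ge> 4"
    and "read_once_function N f"
    and "prob_space M"
    and "prob_space.indep_vars M (\<lambda>_. count_space UNIV) X {..<N}"
    and "\<And>i. i < N \<Longrightarrow> distr M (count_space UNIV) (X i) = uniform_count_measure UNIV"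
  shows "distr M (count_space UNIV) (\<lambda>\<omega>. f (\<lambda>i\<in>{..<N}. X i \<omega>)) \<in> law_body k"
proof -
  interpret prob_space M by fact
  obtain F where F: "distinct (var_leaves F)" "set (var_leaves F) \<subseteq> {..<N}"
    "\<And>x. x \<in> {..<N} \<rightarrow>\<^sub>E UNIV \<Longrightarrow> f x = eval_formula F x"
    using assms(3) by (auto simp: read_once_function_def read_once_def)
  define Y where "Y = (\<lambda>\<omega>. eval_formula F (\<lambda>i. X i \<omega>))"
  have fY: "(\<lambda>\<omega>. f (\<lambda>i\<in>{..<N}. X i \<omega>)) = Y"
  proof
    fix \<omega>
    have "f (\<lambda>i\<in>{..<N}. X i \<omega>) = eval_formula F (\<lambda>i\<in>{..<N}. X i \<omega>)" by (intro F(3)) auto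
    also have "\<dots> = Y \<omega>" unfolding Y_def using F(2) by (intro eval_formula_cong) auto
    finally show "f (\<lambda>i\<in>{..<N}. X i \<omega>) = Y \<omega>" .
  qed
  \<comment> \<open>Independence from a constant is used only to read off the measurability of \<open>Y\<close>.\<close>
  have "indep_var (count_space UNIV) Y (count_space UNIV) (\<lambda>\<omega>. eval_formula (Const 0) (\<lambda>i. X i \<omega>))"
    unfolding Y_def using F(2) by (intro indep_var_eval_formula[OF assms(5)]) auto
  then have Y: "Y \<in> measurable M (count_space UNIV)" by (rule indep_var_rv1)
  define p where "p = distr M (count_space UNIV) Y"
  have p: "space p = UNIV" "sets p = UNIV" by (auto simp: p_def)
  have "measure p {x} = prob {\<omega> \<in> space M. Y \<omega> = x}" for x
    unfolding p_def using Y by (subst measure_distr) (auto intro!: arg_cong[of _ _ prob])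
  then obtain c t where b: "balanced (\<lambda>x. measure p {x}) c t"
    using ex_balanced_eval_formula[OF _ assms(5) _ F(1,2)] assms(1,2,6) by (auto simp: Y_def)
  have "atom_desc p 2 = t" using b by (intro atom_desc_2_eq[OF p(1)]) (auto simp: balanced_def)
  moreover have "psi k t \<le> atom_desc p k"
    using b assms(1,2) by (intro atom_desc_ge[OF p(1)]) (auto simp: balanced_def)
  moreover have "prob_space p" unfolding p_def using Y by (rule prob_space_distr)
  ultimately show ?thesis
    unfolding fY p_def[symmetric] using assms(1) p by (simp add: law_body_def)
qed

end
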